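(* For each fixed natural number $n$, up to switching equivalence there are only finitely many dihedral $\mathrm{ETF}(2n,n)$.
   Context: An $\mathrm{ETF}(2n,n)$ is a family of $2n$ unit vectors in $\mathbb{C}^n$ which is a tight frame (sum of $\varphi_j\varphi_j^*$ equals $2I_n$) and equiangular ($|\langle\varphi_i,\varphi_j\rangle|$ constant for $i\neq j$). $D_n$ is the group generated by $\mu,\tau$ with $\mu^n=\tau^2=1$, $\tau\mu=\mu^{-1}\tau$. A dihedral configuration is a family $(\pi(g)v)_{g\in D_n}$ where $v\in\mathbb{C}^n$ is a unit vector and $\pi:D_n\to U(n)$ is a projective unitary representation (i.e. $\pi(gg')$ equals $\pi(g)\pi(g')$ up to a unimodular scalar), strict or not. Configurations $\Phi,\Psi\in\mathbb{C}^{n\times N}$ are switching equivalent if $\Psi=Q\Phi\Pi^*$ for a unitary $Q$ and a phase monomial matrix $\Pi$ (a diagonal matrix with unimodular diagonal times a permutation matrix). *)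

theory Defs
  imports
    "Jordan_Normal_Form.Schur_Decomposition"
    "HOL-Algebra.Generated_Groups"
begin

section \<open>The dihedral group of order 2n\<close>

text \<open>
  The pair \<open>(a, b)\<close>, with \<open>a\<close> a residue mod \<open>n\<close>, stands for the normal form
  \<open>\<mu>^a\<close> if \<open>b = False\<close> and \<open>\<mu>^a \<tau>\<close> if \<open>b = True\<close>; the product is computed with
  \<open>\<tau> \<mu>^c = \<mu>^(-c) \<tau>\<close>.  The lemmas below confirm that for \<open>n \<ge> 1\<close> this is a group of
  order \<open>2 * n\<close> generated by \<open>\<mu>\<close>, \<open>\<tau>\<close> subject to the dihedral relations.
  For \<open>n = 1, 2\<close> it is the group of order 2 and the Klein four-group.
\<close>

definition dihedral_group :: "nat \<Rightarrow> (int \<times> bool) monoid" where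
  "dihedral_group n =
     \<lparr> carrier = {0..<int n} \<times> UNIV,
       monoid.mult = (\<lambda>(a, b) (c, d). ((a + (if b then - c else c)) mod int n, b \<noteq> d)),
       one = (0, False) \<rparr>"

definition dihedral_mu :: "nat \<Rightarrow> int \<times> bool" where
  "dihedral_mu n = (1 mod int n, False)"

definition dihedral_tau :: "int \<times> bool" where
  "dihedral_tau = (0, True)"

lemma dihedral_group_is_group:
  assumes "n \<ge> 1"
  shows "group (dihedral_group n)"
proof (rule groupI)
  fix x y z
  assume "x \<in> carrier (dihedral_group n)" "y \<in> carrier (dihedral_group n)"
    "z \<in> carrier (dihedral_group n)"
  obtain a b c d e f where [simp]: "x = (a, b)" "y = (c, d)" "z = (e, f)"
    by (cases x, cases y, cases z) auto
  show "x \<otimes>\<^bsub>dihedral_group n\<^esub> y \<otimes>\<^bsub>dihedral_group n\<^esub> z =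
    x \<otimes>\<^bsub>dihedral_group n\<^esub> (y \<otimes>\<^bsub>dihedral_group n\<^esub> z)"
    by (cases b; cases d)
      (simp_all add: dihedral_group_def mod_add_left_eq mod_add_right_eq mod_diff_left_eq
        mod_diff_right_eq add.assoc add.commute[of e c] diff_diff_eq diff_add_eq
        add_diff_eq diff_diff_eq2)
next
  fix x
  assume x: "x \<in> carrier (dihedral_group n)"
  obtain a b where [simp]: "x = (a, b)" by (cases x)
  show "\<exists>y\<in>carrier (dihedral_group n). y \<otimes>\<^bsub>dihedral_group n\<^esub> x = \<one>\<^bsub>dihedral_group n\<^esub>"
  proof (cases b)
    case True
    then show ?thesis
      using x by (intro bexI[of _ "(a, b)"]) (simp_all add: dihedral_group_def)
  next
    case False
    then show ?thesis
      using assms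
      by (intro bexI[of _ "((- a) mod int n, b)"])
        (simp_all add: dihedral_group_def mod_add_left_eq)
  qed
qed (use assms in \<open>auto simp: dihedral_group_def\<close>)

lemma card_dihedral_group: "card (carrier (dihedral_group n)) = 2 * n"
  by (simp add: dihedral_group_def card_cartesian_product)

lemma dihedral_mu_pow:
  "dihedral_mu n [^]\<^bsub>dihedral_group n\<^esub> (k :: nat) = (int k mod int n, False)"
proof (induction k)
  case 0
  then show ?case by (simp add: dihedral_group_def nat_pow_def)
next
  case (Suc k)
  then show ?case
    by (simp add: dihedral_group_def nat_pow_def dihedral_mu_def mod_simps ac_simps)
qed

lemma dihedral_relations:
  assumes "n \<ge> 1"
  shows "dihedral_mu n [^]\<^bsub>dihedral_group n\<^esub> n = \<one>\<^bsub>dihedral_group n\<^esub>"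
    and "dihedral_tau [^]\<^bsub>dihedral_group n\<^esub> (2 :: nat) = \<one>\<^bsub>dihedral_group n\<^esub>"
    and "dihedral_tau \<otimes>\<^bsub>dihedral_group n\<^esub> dihedral_mu n =
      inv\<^bsub>dihedral_group n\<^esub> (dihedral_mu n) \<otimes>\<^bsub>dihedral_group n\<^esub> dihedral_tau"
proof -
  interpret group "dihedral_group n" by (rule dihedral_group_is_group[OF assms])
  show "dihedral_mu n [^]\<^bsub>dihedral_group n\<^esub> n = \<one>\<^bsub>dihedral_group n\<^esub>"
    by (simp add: dihedral_mu_pow) (simp add: dihedral_group_def)
  show "dihedral_tau [^]\<^bsub>dihedral_group n\<^esub> (2 :: nat) = \<one>\<^bsub>dihedral_group n\<^esub>"
    by (simp add: dihedral_tau_def dihedral_group_def nat_pow_def numeral_2_eq_2)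
  have "inv\<^bsub>dihedral_group n\<^esub> (dihedral_mu n) = ((- 1) mod int n, False)"
    by (rule inv_equality) (use assms in \<open>auto simp: dihedral_group_def dihedral_mu_def mod_simps\<close>)
  then show "dihedral_tau \<otimes>\<^bsub>dihedral_group n\<^esub> dihedral_mu n =
      inv\<^bsub>dihedral_group n\<^esub> (dihedral_mu n) \<otimes>\<^bsub>dihedral_group n\<^esub> dihedral_tau"
    by (simp add: dihedral_group_def dihedral_mu_def dihedral_tau_def mod_simps)
qed

lemma dihedral_generated:
  assumes "n \<ge> 1"
  shows "generate (dihedral_group n) {dihedral_mu n, dihedral_tau} = carrier (dihedral_group n)"
    (is "generate ?G ?S = _")
proof
  interpret group ?G by (rule dihedral_group_is_group[OF assms])
  have S: "?S \<subseteq> carrier ?G"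
    using assms by (auto simp: dihedral_group_def dihedral_mu_def dihedral_tau_def)
  show "generate ?G ?S \<subseteq> carrier ?G" by (rule generate_incl[OF S])
  show "carrier ?G \<subseteq> generate ?G ?S"
  proof
    fix x assume x: "x \<in> carrier ?G"
    obtain a b where ab: "x = (a, b)" by (cases x)
    have mem: "dihedral_mu n [^]\<^bsub>?G\<^esub> (k :: nat) \<in> generate ?G ?S" for k
    proof (induction k)
      case 0
      then show ?case by (simp add: generate.one)
    next
      case (Suc k)
      have "dihedral_mu n \<in> generate ?G ?S" by (rule generate.incl) simp
      with Suc show ?case unfolding nat_pow_Suc by (rule generate.eng)
    qed
    have pw: "dihedral_mu n [^]\<^bsub>?G\<^esub> nat a = (a, False)"
      using x ab assms by (auto simp: dihedral_mu_pow) (auto simp: dihedral_group_def)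
    show "x \<in> generate ?G ?S"
    proof (cases b)
      case True
      have "(a, False) \<otimes>\<^bsub>?G\<^esub> dihedral_tau \<in> generate ?G ?S"
        using mem[of "nat a"] unfolding pw by (rule generate.eng) (rule generate.incl, simp)
      also have "(a, False) \<otimes>\<^bsub>?G\<^esub> dihedral_tau = x"
        using x ab True by (simp add: dihedral_group_def dihedral_tau_def)
      finally show ?thesis .
    next
      case False
      then show ?thesis using mem[of "nat a"] ab by (simp add: pw)
    qed
  qed
qed


section \<open>Unitary and phase monomial matrices\<close>

definition unitary_group :: "nat \<Rightarrow> complex mat set" where
  "unitary_group n =
     {Q \<in> carrier_mat n n. Q * mat_adjoint Q = 1\<^sub>m n \<and> mat_adjoint Q * Q = 1\<^sub>m n}"

definition unimodular_diagonal :: "nat \<Rightarrow> complex mat \<Rightarrow> bool" where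
  "unimodular_diagonal N D \<longleftrightarrow>
     D \<in> carrier_mat N N \<and> diagonal_mat D \<and> (\<forall>i<N. cmod (D $$ (i, i)) = 1)"

definition permutation_matrix :: "nat \<Rightarrow> complex mat \<Rightarrow> bool" where
  "permutation_matrix N P \<longleftrightarrow>
     (\<exists>p. p permutes {..<N} \<and> P = mat N N (\<lambda>(i, j). if i = p j then 1 else 0))"

definition phase_monomial :: "nat \<Rightarrow> complex mat \<Rightarrow> bool" where
  "phase_monomial N M \<longleftrightarrow>
     (\<exists>D P. unimodular_diagonal N D \<and> permutation_matrix N P \<and> M = D * P)"


section \<open>Configurations\<close>

text \<open>
  A configuration of \<open>N\<close> vectors in \<open>\<complex>\<^sup>n\<close> is the matrix in \<open>carrier_mat n N\<close> whose columns
  are these vectors.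
\<close>

definition switching_equiv :: "nat \<Rightarrow> nat \<Rightarrow> (complex mat \<times> complex mat) set" where
  "switching_equiv n N =
     {(\<Phi>, \<Psi>). \<Phi> \<in> carrier_mat n N \<and> \<Psi> \<in> carrier_mat n N \<and>
        (\<exists>Q M. Q \<in> unitary_group n \<and> phase_monomial N M \<and> \<Psi> = Q * \<Phi> * mat_adjoint M)}"

text \<open>
  The product \<open>\<Phi> * mat_adjoint \<Phi>\<close> is the frame operator, the sum of \<open>\<phi>\<^sub>j \<phi>\<^sub>j\<^sup>*\<close> over the
  columns \<open>\<phi>\<^sub>j\<close> of \<open>\<Phi>\<close>; see \<open>frame_operator_entry\<close> below.
\<close>

definition ETF_2n_n :: "nat \<Rightarrow> complex mat \<Rightarrow> bool" where
  "ETF_2n_n n \<Phi> \<longleftrightarrow>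
     \<Phi> \<in> carrier_mat n (2 * n) \<and>
     (\<forall>j<2 * n. col \<Phi> j \<bullet>c col \<Phi> j = 1) \<and>
     \<Phi> * mat_adjoint \<Phi> = 2 \<cdot>\<^sub>m 1\<^sub>m n \<and>
     (\<exists>\<alpha>::real. \<forall>i<2 * n. \<forall>j<2 * n. i \<noteq> j \<longrightarrow> cmod (col \<Phi> i \<bullet>c col \<Phi> j) = \<alpha>)"

definition projective_unitary_rep ::
    "('g, 'm) monoid_scheme \<Rightarrow> nat \<Rightarrow> ('g \<Rightarrow> complex mat) \<Rightarrow> bool" where
  "projective_unitary_rep G n \<pi> \<longleftrightarrow>
     (\<forall>g\<in>carrier G. \<pi> g \<in> unitary_group n) \<and>
     (\<forall>g\<in>carrier G. \<forall>h\<in>carrier G. \<exists>c. cmod c = 1 \<and> \<pi> (g \<otimes>\<^bsub>G\<^esub> h) = c \<cdot>\<^sub>m (\<pi> g * \<pi> h))"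

text \<open>
  The family is indexed by the group, the matrix by \<open>{..<2 * n}\<close>; any enumeration \<open>e\<close> of
  the group may be used to order the columns.
\<close>

definition dihedral_configuration :: "nat \<Rightarrow> complex mat \<Rightarrow> bool" where
  "dihedral_configuration n \<Phi> \<longleftrightarrow>
     \<Phi> \<in> carrier_mat n (2 * n) \<and>
     (\<exists>\<pi> v e. projective_unitary_rep (dihedral_group n) n \<pi> \<and>
        v \<in> carrier_vec n \<and> v \<bullet>c v = 1 \<and>
        bij_betw e {..<2 * n} (carrier (dihedral_group n)) \<and>
        (\<forall>j<2 * n. col \<Phi> j = \<pi> (e j) *\<^sub>v v))"


section \<open>Sanity checks\<close>

lemma mat_adjoint_dims [simp]:
  "dim_row (mat_adjoint (A :: complex mat)) = dim_col A"
  "dim_col (mat_adjoint (A :: complex mat)) = dim_row A"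
  by (simp_all add: mat_adjoint_def)
lemma mat_adjoint_entry:
  "i < dim_col (A :: complex mat) \<Longrightarrow> j < dim_row A \<Longrightarrow> mat_adjoint A $$ (i, j) = cnj (A $$ (j, i))"
  by (simp add: mat_adjoint_def mat_of_rows_index)

lemma mat_adjoint_carrier [simp]:
  "(A :: complex mat) \<in> carrier_mat n m \<Longrightarrow> mat_adjoint A \<in> carrier_mat m n"
  by (intro carrier_matI) simp_all

lemma mat_adjoint_mat_adjoint [simp]: "mat_adjoint (mat_adjoint A) = (A :: complex mat)"
  by (rule eq_matI) (simp_all add: mat_adjoint_entry)

lemma mat_adjoint_one [simp]: "mat_adjoint (1\<^sub>m n :: complex mat) = 1\<^sub>m n"
  by (rule eq_matI) (simp_all add: mat_adjoint_entry)

lemma mat_adjoint_mult: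
  assumes "(A :: complex mat) \<in> carrier_mat n m" "B \<in> carrier_mat m k"
  shows "mat_adjoint (A * B) = mat_adjoint B * mat_adjoint A"
  by (rule eq_matI) (use assms in \<open>auto simp: mat_adjoint_entry scalar_prod_def intro!: sum.cong\<close>)

lemma frame_operator_entry:
  assumes "\<Phi> \<in> carrier_mat n N" "k < n" "l < n"
  shows "(\<Phi> * mat_adjoint \<Phi>) $$ (k, l) = (\<Sum>j<N. col \<Phi> j $ k * cnj (col \<Phi> j $ l))"
  using assms by (auto simp: scalar_prod_def mat_adjoint_entry atLeast0LessThan intro!: sum.cong)

lemma phase_monomial_iff:
  "phase_monomial N M \<longleftrightarrow>
     (\<exists>p d. p permutes {..<N} \<and> (\<forall>i<N. cmod (d i) = 1) \<and>
        M = mat N N (\<lambda>(i, j). if i = p j then d i else 0))" (is "?L = ?R")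
proof
  assume ?L
  then obtain D P p where D: "unimodular_diagonal N D" and p: "p permutes {..<N}"
    and P: "P = mat N N (\<lambda>(i, j). if i = p j then 1 else 0)" and M: "M = D * P"
    by (auto simp: phase_monomial_def permutation_matrix_def)
  have "M = mat N N (\<lambda>(i, j). if i = p j then D $$ (i, i) else 0)"
  proof (rule eq_matI)
    fix i j assume ij: "i < dim_row (mat N N (\<lambda>(i, j). if i = p j then D $$ (i, i) else 0))"
      "j < dim_col (mat N N (\<lambda>(i, j). if i = p j then D $$ (i, i) else 0))"
    have "M $$ (i, j) = (\<Sum>k = 0..<N. D $$ (i, k) * (if k = p j then 1 else 0))"
      using ij D by (auto simp: M P scalar_prod_def unimodular_diagonal_def intro!: sum.cong)
    also have "\<dots> = (\<Sum>k = 0..<N. if k = i then (if i = p j then D $$ (i, i) else 0) else 0)"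
      using ij D by (intro sum.cong) (auto simp: unimodular_diagonal_def diagonal_mat_def)
    finally show "M $$ (i, j) = mat N N (\<lambda>(i, j). if i = p j then D $$ (i, i) else 0) $$ (i, j)"
      using ij by simp
  qed (use D in \<open>auto simp: M P unimodular_diagonal_def\<close>)
  with D p show ?R unfolding unimodular_diagonal_def by (intro exI[of _ p] exI[of _ "\<lambda>i. D $$ (i, i)"]) auto
next
  assume ?R
  then obtain p d where p: "p permutes {..<N}" and d: "\<forall>i<N. cmod (d i) = 1"
    and M: "M = mat N N (\<lambda>(i, j). if i = p j then d i else 0)" by auto
  define D where "D = mat N N (\<lambda>(i, j). if i = j then d i else 0)"
  define P where "P = mat N N (\<lambda>(i, j). if i = p j then 1 else 0 :: complex)"
  have "M = D * P"
  proof (rule eq_matI)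
    fix i j assume ij: "i < dim_row (D * P)" "j < dim_col (D * P)"
    then have "(D * P) $$ (i, j) = (\<Sum>k = 0..<N. (if i = k then d i else 0) * (if k = p j then 1 else 0))"
      by (auto simp: D_def P_def scalar_prod_def intro!: sum.cong)
    also have "\<dots> = (\<Sum>k = 0..<N. if k = i then (if i = p j then d i else 0) else 0)"
      by (intro sum.cong) auto
    finally show "M $$ (i, j) = (D * P) $$ (i, j)"
      using ij by (simp add: M D_def P_def)
  qed (auto simp: M D_def P_def)
  moreover have "unimodular_diagonal N D"
    using d by (auto simp: D_def unimodular_diagonal_def diagonal_mat_def)
  ultimately show ?L using p unfolding phase_monomial_def permutation_matrix_def P_def by blast
qed

lemma phase_monomial_carrier: "phase_monomial N M \<Longrightarrow> M \<in> carrier_mat N N"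
  by (auto simp: phase_monomial_iff)

lemma phase_monomial_one: "phase_monomial N (1\<^sub>m N)"
  unfolding phase_monomial_iff
  by (intro exI[of _ id] exI[of _ "\<lambda>_. 1"]) (auto simp: permutes_id intro!: eq_matI)

lemma phase_monomial_adjoint:
  assumes "phase_monomial N M"
  shows "phase_monomial N (mat_adjoint M)"
proof -
  from assms obtain p d where p: "p permutes {..<N}" and d: "\<forall>i<N. cmod (d i) = 1"
    and M: "M = mat N N (\<lambda>(i, j). if i = p j then d i else 0)" by (auto simp: phase_monomial_iff)
  have pl: "p i < N" if "i < N" for i using permutes_in_image[OF p, of i] that by simp
  have "mat_adjoint M = mat N N (\<lambda>(i, j). if i = Hilbert_Choice.inv p j then cnj (d (p i)) else 0)"
    by (rule eq_matI) (auto simp: M mat_adjoint_entry permutes_inverses[OF p])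
  then show ?thesis
    unfolding phase_monomial_iff using permutes_inv[OF p] d pl
    by (intro exI[of _ "Hilbert_Choice.inv p"] exI[of _ "\<lambda>i. cnj (d (p i))"]) auto
qed

lemma phase_monomial_mult:
  assumes "phase_monomial N M" "phase_monomial N M'"
  shows "phase_monomial N (M * M')"
proof -
  from assms obtain p d q f where p: "p permutes {..<N}" and d: "\<forall>i<N. cmod (d i) = 1"
    and M: "M = mat N N (\<lambda>(i, j). if i = p j then d i else 0)"
    and q: "q permutes {..<N}" and f: "\<forall>i<N. cmod (f i) = 1"
    and M': "M' = mat N N (\<lambda>(i, j). if i = q j then f i else 0)"
    by (auto simp: phase_monomial_iff)
  have ql: "q i < N" if "i < N" for i using permutes_in_image[OF q, of i] that by simp
  have il: "Hilbert_Choice.inv p i < N" if "i < N" for i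
    using permutes_in_image[OF permutes_inv[OF p], of i] that by simp
  have "M * M' = mat N N (\<lambda>(i, j). if i = (p \<circ> q) j then d i * f (Hilbert_Choice.inv p i) else 0)" (is "_ = ?R")
  proof (rule eq_matI)
    fix i j assume ij: "i < dim_row ?R" "j < dim_col ?R"
    then have "(M * M') $$ (i, j) =
        (\<Sum>k = 0..<N. (if i = p k then d i else 0) * (if k = q j then f k else 0))"
      by (auto simp: M M' scalar_prod_def intro!: sum.cong)
    also have "\<dots> = (\<Sum>k = 0..<N. if k = q j then (if i = p (q j) then d i * f (q j) else 0) else 0)"
      by (intro sum.cong) auto
    finally show "(M * M') $$ (i, j) = ?R $$ (i, j)"
      using ij ql by (auto simp: permutes_inverses[OF p])
  qed (auto simp: M M')
  then show ?thesis
    unfolding phase_monomial_iff using permutes_compose[OF q p] d f il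
    by (intro exI[of _ "p \<circ> q"] exI[of _ "\<lambda>i. d i * f (Hilbert_Choice.inv p i)"]) (auto simp: norm_mult)
qed

lemma phase_monomial_unitary:
  assumes "phase_monomial N M"
  shows "M \<in> unitary_group N"
proof -
  from assms obtain p d where p: "p permutes {..<N}" and d: "\<forall>i<N. cmod (d i) = 1"
    and M: "M = mat N N (\<lambda>(i, j). if i = p j then d i else 0)" by (auto simp: phase_monomial_iff)
  have pl: "p i < N" if "i < N" for i using permutes_in_image[OF p, of i] that by simp
  have d1: "cnj (d i) * d i = 1" if "i < N" for i
    using d that by (metis complex_norm_square mult.commute of_real_1 one_power2)
  have 1: "mat_adjoint M * M = 1\<^sub>m N"
  proof (rule eq_matI)
    fix i j assume ij: "i < dim_row (1\<^sub>m N :: complex mat)" "j < dim_col (1\<^sub>m N :: complex mat)"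
    then have "(mat_adjoint M * M) $$ (i, j) =
        (\<Sum>k = 0..<N. (if k = p i then cnj (d k) else 0) * (if k = p j then d k else 0))"
      by (auto simp: M mat_adjoint_entry scalar_prod_def intro!: sum.cong)
    also have "\<dots> = (\<Sum>k = 0..<N. if k = p i then (if p i = p j then cnj (d (p i)) * d (p i) else 0) else 0)"
      by (intro sum.cong) auto
    finally show "(mat_adjoint M * M) $$ (i, j) = 1\<^sub>m N $$ (i, j)"
      using ij pl d1 by (auto simp: inj_eq[OF permutes_inj[OF p]])
  qed (auto simp: M)
  then have "M * mat_adjoint M = 1\<^sub>m N"
    by (rule mat_mult_left_right_inverse[rotated 2]) (auto simp: M)
  with 1 show ?thesis by (auto simp: unitary_group_def M)
qed

lemma unitary_group_mult:
  assumes "Q \<in> unitary_group n" "R \<in> unitary_group n"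
  shows "Q * R \<in> unitary_group n"
proof -
  have c: "Q \<in> carrier_mat n n" "R \<in> carrier_mat n n"
    "mat_adjoint Q \<in> carrier_mat n n" "mat_adjoint R \<in> carrier_mat n n"
    using assms by (auto simp: unitary_group_def)
  have "Q * R * mat_adjoint (Q * R) = Q * (R * mat_adjoint R) * mat_adjoint Q"
    using c by (simp add: mat_adjoint_mult[of Q n n R n] assoc_mult_mat[of _ n n _ n _ n] mult_carrier_mat[of _ n n _ n])
  moreover have "mat_adjoint (Q * R) * (Q * R) = mat_adjoint R * (mat_adjoint Q * Q) * R"
    using c by (simp add: mat_adjoint_mult[of Q n n R n] assoc_mult_mat[of _ n n _ n _ n] mult_carrier_mat[of _ n n _ n])
  ultimately show ?thesis
    using assms c by (auto simp: unitary_group_def)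
qed

lemma switching_equiv_equiv: "equiv (carrier_mat n N) (switching_equiv n N)"
proof (rule equivI)
  show "switching_equiv n N \<subseteq> carrier_mat n N \<times> carrier_mat n N"
    unfolding switching_equiv_def by blast
  show "refl_on (carrier_mat n N) (switching_equiv n N)"
  proof (rule refl_onI)
    fix A :: "complex mat" assume A: "A \<in> carrier_mat n N"
    have "1\<^sub>m n \<in> unitary_group n" by (auto simp: unitary_group_def)
    moreover have "A = 1\<^sub>m n * A * mat_adjoint (1\<^sub>m N)" using A by simp
    ultimately show "(A, A) \<in> switching_equiv n N"
      using A phase_monomial_one unfolding switching_equiv_def by blast
  qed
  show "sym (switching_equiv n N)"
  proof (rule symI)
    fix A B assume "(A, B) \<in> switching_equiv n N"
    then obtain Q M where A: "A \<in> carrier_mat n N" and B: "B \<in> carrier_mat n N"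
      and Q: "Q \<in> unitary_group n" and M: "phase_monomial N M" and eq: "B = Q * A * mat_adjoint M"
      by (auto simp: switching_equiv_def)
    have MU: "M \<in> unitary_group N" by (rule phase_monomial_unitary[OF M])
    have c: "Q \<in> carrier_mat n n" "mat_adjoint Q \<in> carrier_mat n n"
      "M \<in> carrier_mat N N" "mat_adjoint M \<in> carrier_mat N N"
      using Q MU by (auto simp: unitary_group_def)
    have "mat_adjoint Q * B * M = mat_adjoint Q * (Q * (A * (mat_adjoint M * M)))"
      using A c by (simp add: eq assoc_mult_mat[of _ n n _ N _ N] assoc_mult_mat[of _ n n _ n _ N]
          assoc_mult_mat[of _ n N _ N _ N])
    also have "\<dots> = (mat_adjoint Q * Q) * A"
      using A c MU by (simp add: unitary_group_def assoc_mult_mat[of _ n n _ n _ N])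
    also have "\<dots> = A" using A Q by (simp add: unitary_group_def)
    finally have "A = mat_adjoint Q * B * mat_adjoint (mat_adjoint M)" by simp
    moreover have "mat_adjoint Q \<in> unitary_group n" using Q by (auto simp: unitary_group_def)
    ultimately show "(B, A) \<in> switching_equiv n N"
      using A B phase_monomial_adjoint[OF M] unfolding switching_equiv_def by blast
  qed
  show "trans (switching_equiv n N)"
  proof (rule transI)
    fix A B C assume "(A, B) \<in> switching_equiv n N" "(B, C) \<in> switching_equiv n N"
    then obtain Q M R L where A: "A \<in> carrier_mat n N" and C: "C \<in> carrier_mat n N"
      and Q: "Q \<in> unitary_group n" and M: "phase_monomial N M" and B: "B = Q * A * mat_adjoint M"
      and R: "R \<in> unitary_group n" and L: "phase_monomial N L" and eq: "C = R * B * mat_adjoint L"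
      by (auto simp: switching_equiv_def)
    have c: "Q \<in> carrier_mat n n" "R \<in> carrier_mat n n" "M \<in> carrier_mat N N" "L \<in> carrier_mat N N"
      "mat_adjoint M \<in> carrier_mat N N" "mat_adjoint L \<in> carrier_mat N N"
      using Q R phase_monomial_carrier[OF M] phase_monomial_carrier[OF L]
      by (auto simp: unitary_group_def)
    have QA: "Q * A \<in> carrier_mat n N" using c A by simp
    have "C = R * (Q * A) * mat_adjoint M * mat_adjoint L"
      unfolding eq B using c assoc_mult_mat[OF c(2) QA c(5)] by simp
    also have "\<dots> = R * (Q * A) * (mat_adjoint M * mat_adjoint L)"
      by (rule assoc_mult_mat[OF mult_carrier_mat[OF c(2) QA] c(5,6)])
    also have "R * (Q * A) = R * Q * A"
      by (rule assoc_mult_mat[OF c(2,1) A, symmetric])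
    also have "mat_adjoint M * mat_adjoint L = mat_adjoint (L * M)"
      by (rule mat_adjoint_mult[OF c(4,3), symmetric])
    finally have "C = (R * Q) * A * mat_adjoint (L * M)" .
    then show "(A, C) \<in> switching_equiv n N"
      using A C unitary_group_mult[OF R Q] phase_monomial_mult[OF L M]
      unfolding switching_equiv_def by blast
  qed
qed

end

theory Submission
  imports Defs
begin

text \<open>
  After rescaling, a projective representation of the dihedral group is given by unitaries \<open>U\<close>, \<open>T\<close>
  with \<open>T\<^sup>2 = 1\<close>, \<open>U T U = T\<close> and \<open>U\<^sup>n = \<theta>\<close>, \<open>\<theta> = 1\<close> or \<open>-1\<close>.  Every \<open>U\<^sup>k T\<close> is then a unitary involution, hence
  self-adjoint, so the Gram entries \<open>b\<^sub>k = \<langle>U\<^sup>k T v, v\<rangle>\<close> of an ETF are real of fixed modulus, and only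
  finitely many sequences \<open>b\<close> occur.  Since the Gram matrix \<open>G\<close> satisfies \<open>G\<^sup>2 = 2 G\<close>, for every \<open>w\<close> with
  \<open>w\<^sup>n = \<theta>\<close> the sum of the \<open>\<langle>U\<^sup>k v, v\<rangle> w\<^sup>k\<close> solves a monic quadratic equation determined by \<open>b\<close>, so by
  Fourier inversion only finitely many Gram matrices occur.  Tight frames with equal Gram matrices
  differ by a unitary.
\<close>

section \<open>Periodic sums, finite quotients and Fourier inversion\<close>

text \<open>Moving the window by one drops \<open>g k\<close> and adds \<open>g (int n + k)\<close>,
  which agree by periodicity; induction in both directions then reaches every integer
  offset.\<close>

lemma periodic_sum_shift:
  fixes g :: "int \<Rightarrow> 'a :: ab_group_add"
  assumes per: "\<And>k. g (k + int n) = g k"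
  shows "(\<Sum>m<n. g (int m + k)) = (\<Sum>m<n. g (int m))"
proof -
  have step: "(\<Sum>m<n. g (int m + (k + 1))) = (\<Sum>m<n. g (int m + k))" for k
  proof -
    have "(\<Sum>m<n. g (int m + (k + 1))) = (\<Sum>m<n. g (int (Suc m) + k))"
      by (simp add: algebra_simps)
    moreover have "(\<Sum>m<n. g (int m + k)) + g (int n + k) = g k + (\<Sum>m<n. g (int (Suc m) + k))"
      using sum.lessThan_Suc_shift[of "\<lambda>m. g (int m + k)" n] by simp
    ultimately show ?thesis
      using per[of k] by (simp add: add.commute)
  qed
  show ?thesis
  proof (induction k rule: int_induct[of _ 0])
    case (step2 i)
    then show ?case using step[of "i - 1"] by simp
  qed (simp_all add: step)
qed

text \<open>Reversing the order of summation turns the reflected window into a shifted one.\<close>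

lemma periodic_sum_reflect:
  fixes g :: "int \<Rightarrow> 'a :: ab_group_add"
  assumes "\<And>k. g (k + int n) = g k"
  shows "(\<Sum>m<n. g (k - int m)) = (\<Sum>m<n. g (int m))"
proof -
  have "(\<Sum>m<n. g (k - int m)) = (\<Sum>m<n. g (k - int (n - Suc m)))"
    by (rule sum.nat_diff_reindex[symmetric])
  also have "\<dots> = (\<Sum>m<n. g (int m + (k - int n + 1)))"
    by (rule sum.cong) (auto simp: of_nat_diff algebra_simps)
  also have "\<dots> = (\<Sum>m<n. g (int m))"
    by (rule periodic_sum_shift) (rule assms)
  finally show ?thesis .
qed

text \<open>Every class meeting \<open>X\<close> contains an element satisfying \<open>P\<close>
  whose \<open>h\<close>-value lies in the finite set \<Gamma>, and among such elements equal values
  force equal classes. So one representative chosen per value exhausts the quotient.\<close>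

lemma finite_quotient_by_invariant:
  assumes R: "equiv A R" and "finite \<Gamma>"
    and rep: "\<And>x. x \<in> X \<Longrightarrow> \<exists>y. (x, y) \<in> R \<and> P y \<and> h y \<in> \<Gamma>"
    and inv: "\<And>y z. P y \<Longrightarrow> P z \<Longrightarrow> h y = h z \<Longrightarrow> (y, z) \<in> R"
  shows "finite (X // R)"
proof (rule finite_subset)
  show "X // R \<subseteq> (\<lambda>\<gamma>. R `` {SOME y. P y \<and> h y = \<gamma>}) ` \<Gamma>"
  proof
    fix c assume "c \<in> X // R"
    then obtain x where x: "x \<in> X" "c = R `` {x}" by (auto simp: quotient_def)
    from rep[OF x(1)] obtain y where y: "(x, y) \<in> R" "P y" "h y \<in> \<Gamma>" by blast
    \<comment> \<open>The choice depends on \<open>h y\<close> alone, not on \<open>y\<close>, so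
      the class is recovered from a single element of \<Gamma>.\<close>
    define z where "z = (SOME z. P z \<and> h z = h y)"
    have "P z \<and> h z = h y"
      unfolding z_def by (rule someI[of _ y]) (simp add: y)
    then have "(y, z) \<in> R" using inv[of y z] y by simp
    then have "c = R `` {z}"
      using equiv_class_eq[OF R] y(1) x(2) by metis
    then show "c \<in> (\<lambda>\<gamma>. R `` {SOME y. P y \<and> h y = \<gamma>}) ` \<Gamma>"
      using y(3) unfolding z_def by blast
  qed
qed (use assms in simp)

text \<open>A sequence \<open>a\<close> is determined by the values of its polynomial at the \<open>n\<close> distinct roots \<open>w\<close>.\<close>

lemma finite_coeffs_quadratic_at_roots:
  fixes \<theta> :: complex and c :: "complex \<Rightarrow> complex"
  assumes "n > 0" "\<theta> \<noteq> 0"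
  shows "finite {a \<in> {..<n} \<rightarrow>\<^sub>E UNIV.
    \<forall>w. w ^ n = \<theta> \<longrightarrow> (\<Sum>k<n. a k * w ^ k)\<^sup>2 + c w = 2 * (\<Sum>k<n. a k * w ^ k)}" (is "finite ?A")
proof -
  define \<Omega> where "\<Omega> = {w :: complex. w ^ n = \<theta>}"
  define ev where "ev a = (\<lambda>w\<in>\<Omega>. \<Sum>k<n. a k * w ^ k)" for a :: "nat \<Rightarrow> complex"
  have card: "card \<Omega> = n"
    unfolding \<Omega>_def by (rule card_nth_roots) (use assms in auto)
  have fin: "finite \<Omega>"
    using card assms by (metis card.infinite less_irrefl)
  have quad: "finite {z :: complex. z\<^sup>2 + d = 2 * z}" for d
  proof -
    \<comment> \<open>Completing the square reduces the count to square roots of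
      \<open>1 - d\<close>.\<close>
    have "{z. z\<^sup>2 + d = 2 * z} = {z. (z - 1)\<^sup>2 = 1 - d}"
      by (auto simp: power2_eq_square algebra_simps)
    also have "\<dots> = (\<lambda>x. x + 1) ` {x. x\<^sup>2 = 1 - d}"
      by (auto simp: image_iff intro!: exI[of _ "_ - 1"])
    finally show ?thesis by (simp add: finite_nth_roots)
  qed
  have "ev ` ?A \<subseteq> PiE \<Omega> (\<lambda>w. {z. z\<^sup>2 + c w = 2 * z})"
    by (auto simp: ev_def \<Omega>_def PiE_def)
  moreover have "finite (PiE \<Omega> (\<lambda>w. {z. z\<^sup>2 + c w = 2 * z}))"
    using fin quad by (intro finite_PiE) auto
  ultimately have "finite (ev ` ?A)" by (rule finite_subset)
  moreover have "inj_on ev ?A"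
  proof (rule inj_onI)
    fix a b assume a: "a \<in> ?A" and b: "b \<in> ?A" and eq: "ev a = ev b"
    \<comment> \<open>The differences \<open>a k - b k\<close> are the coefficients of a polynomial
      of degree at most \<open>n - 1\<close>. It vanishes at all \<open>n\<close> elements of
      \<Omega>, so a nonzero coefficient would give it too many roots.\<close>
    have sub: "\<Omega> \<subseteq> {w. (\<Sum>k\<le>n - 1. (a k - b k) * w ^ k) = 0}"
    proof
      fix w assume w: "w \<in> \<Omega>"
      then have "(\<Sum>k<n. a k * w ^ k) = (\<Sum>k<n. b k * w ^ k)"
        using fun_cong[OF eq, of w] by (simp add: ev_def)
      moreover have "{..n - 1} = {..<n}" using assms by auto
      ultimately show "w \<in> {w. (\<Sum>k\<le>n - 1. (a k - b k) * w ^ k) = 0}"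
        by (simp add: algebra_simps sum_subtractf)
    qed
    have "a k = b k" if "k < n" for k
    proof (rule ccontr)
      assume "a k \<noteq> b k"
      then have "a k - b k \<noteq> 0" "k \<le> n - 1" using that by auto
      from polyfun_roots_finite[of "\<lambda>k. a k - b k", OF this] polyfun_roots_card[of "\<lambda>k. a k - b k", OF this]
      have "card \<Omega> \<le> n - 1"
        using sub card_mono order_trans by blast
      then show False using card assms by simp
    qed
    then show "a = b"
      using a b by (intro PiE_ext[of a "{..<n}" _ b]) auto
  qed
  ultimately show ?thesis by (rule finite_imageD)
qed

text \<open>Multiplying the convolution identity \<open>conv\<close> by \<open>w ^ m\<close> and
  summing over \<open>m\<close> turns the first convolution into a square. The second one, a
  correlation, becomes a product of values at \<open>w\<close> and at
  \<open>inverse w\<close>.\<close>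

lemma fourier_quadratic:
  fixes a b :: "int \<Rightarrow> complex"
  assumes th: "\<theta>\<^sup>2 = 1" and w: "w ^ n = \<theta>" and n: "n > 0"
    and a: "\<And>k. a (k + int n) = \<theta> * a k" and b: "\<And>k. b (k + int n) = \<theta> * b k"
    and conv: "\<And>m. m < n \<Longrightarrow> (\<Sum>k<n. a (int k) * a (int m - int k)) + (\<Sum>k<n. b (int k) * b (int k - int m)) = 2 * a (int m)"
  shows "(\<Sum>k<n. a (int k) * w ^ k)\<^sup>2 + (\<Sum>k<n. b (int k) * w ^ k) * (\<Sum>k<n. b (int k) * inverse w ^ k)
    = 2 * (\<Sum>k<n. a (int k) * w ^ k)"
proof -
  have w0: "w \<noteq> 0" using w th n by (auto simp: power_0_left)
  \<comment> \<open>As \<theta> is its own inverse, positive and negative powers of \<open>w\<close>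
    pick up the same factor under a shift of the exponent by \<open>n\<close>.\<close>
  have thi: "inverse \<theta> = \<theta>" using th by (metis inverse_unique power2_eq_square)
  have wi: "w powi (k + int n) = \<theta> * w powi k" "w powi (- (k + int n)) = \<theta> * w powi (- k)" for k
    using w0 w thi by (simp_all add: power_int_add power_int_minus del: minus_add_distrib)
  \<comment> \<open>The twist by powers of \<open>w\<close> cancels the factor \<theta>:
    \<open>f\<close> and \<open>g\<close> are periodic, while \<open>a\<close> and \<open>b\<close>
    are so only up to \<theta>.\<close>
  define f where "f k = a k * w powi k" for k
  define g where "g k = b k * w powi (- k)" for k
  have f: "f (k + int n) = f k" for k
    using th by (simp add: f_def a wi power2_eq_square)
  have g: "g (k + int n) = g k" for k
    using th by (simp add: g_def b wi power2_eq_square del: minus_add_distrib)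
  have f': "(\<Sum>m<n. f (int m)) = (\<Sum>m<n. a (int m) * w ^ m)"
    by (simp add: f_def)
  have g': "(\<Sum>m<n. g (int m)) = (\<Sum>m<n. b (int m) * inverse w ^ m)"
    by (simp add: g_def power_int_minus power_inverse)
  have "2 * (\<Sum>m<n. a (int m) * w ^ m) = (\<Sum>m<n. 2 * a (int m) * w ^ m)"
    by (simp add: sum_distrib_left mult.assoc)
  also have "\<dots> = (\<Sum>m<n. (\<Sum>k<n. a (int k) * w ^ k * f (int m - int k)) +
      (\<Sum>k<n. b (int k) * w ^ k * g (int k - int m)))"
  proof (rule sum.cong[OF refl])
    fix m assume m: "m \<in> {..<n}"
    have s: "w ^ m = w ^ k * w powi (int m - int k)" for k
      using w0 by (simp add: power_int_diff)
    have s': "w powi (- (int k - int m)) = w powi (int m - int k)" for k by simp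
    have "2 * a (int m) * w ^ m =
       (\<Sum>k<n. a (int k) * a (int m - int k) * w ^ m) + (\<Sum>k<n. b (int k) * b (int k - int m) * w ^ m)"
      using conv[of m, symmetric] m by (simp add: distrib_right sum_distrib_right)
    also have "(\<Sum>k<n. a (int k) * a (int m - int k) * w ^ m) = (\<Sum>k<n. a (int k) * w ^ k * f (int m - int k))"
      by (rule sum.cong) (auto simp: f_def s[symmetric] ac_simps)
    also have "(\<Sum>k<n. b (int k) * b (int k - int m) * w ^ m) = (\<Sum>k<n. b (int k) * w ^ k * g (int k - int m))"
      unfolding g_def s' by (rule sum.cong) (auto simp: s[symmetric] ac_simps)
    finally show "2 * a (int m) * w ^ m = (\<Sum>k<n. a (int k) * w ^ k * f (int m - int k)) +
      (\<Sum>k<n. b (int k) * w ^ k * g (int k - int m))" .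
  qed
  \<comment> \<open>After the interchange each inner sum runs over one full period and no longer
    depends on \<open>k\<close>, so the double sums factor.\<close>
  also have "\<dots> = (\<Sum>k<n. a (int k) * w ^ k * (\<Sum>m<n. f (int m - int k))) +
      (\<Sum>k<n. b (int k) * w ^ k * (\<Sum>m<n. g (int k - int m)))"
    unfolding sum.distrib sum_distrib_left by (intro arg_cong2[of _ _ _ _ "(+)"] sum.swap)
  also have "\<dots> = (\<Sum>k<n. a (int k) * w ^ k * (\<Sum>m<n. f (int m))) +
      (\<Sum>k<n. b (int k) * w ^ k * (\<Sum>m<n. g (int m)))"
    using periodic_sum_shift[of f n "- int k" for k, OF f] periodic_sum_reflect[of g n, OF g] by simp
  finally show ?thesis
    unfolding f' g' by (simp add: sum_distrib_right power2_eq_square)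
qed

section \<open>Scalar multiples, adjoints and unitary matrices\<close>

lemma cmod_mult_cnj: "cmod c = 1 \<Longrightarrow> c * cnj c = 1"
  by (metis complex_norm_square of_real_1 one_power2)

lemma mat_adjoint_smult: "mat_adjoint (c \<cdot>\<^sub>m A) = cnj c \<cdot>\<^sub>m mat_adjoint A"
  by (rule eq_matI) (simp_all add: mat_adjoint_entry)

lemma smult_smult_mat: "c \<cdot>\<^sub>m (d \<cdot>\<^sub>m A) = (c * d) \<cdot>\<^sub>m (A :: 'a :: semigroup_mult mat)"
  by (rule eq_matI) (simp_all add: mult.assoc)

lemma one_smult_mat [simp]: "1 \<cdot>\<^sub>m (A :: 'a :: monoid_mult mat) = A"
  by (rule eq_matI) simp_all

lemma smult_mult_mat:
  assumes "A \<in> carrier_mat n m" "B \<in> carrier_mat m k"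
  shows "(c \<cdot>\<^sub>m A) * (d \<cdot>\<^sub>m B) = (c * d) \<cdot>\<^sub>m (A * B :: 'a :: comm_semiring_1 mat)"
proof -
  have "(c \<cdot>\<^sub>m A) * (d \<cdot>\<^sub>m B) = c \<cdot>\<^sub>m (A * (d \<cdot>\<^sub>m B))"
    using assms by (intro mult_smult_assoc_mat[of _ n m _ k]) auto
  also have "A * (d \<cdot>\<^sub>m B) = d \<cdot>\<^sub>m (A * B)"
    using assms by (intro mult_smult_distrib[of _ n m _ k]) auto
  finally show ?thesis by (simp add: smult_smult_mat)
qed

lemma smult_mat_mult_vec:
  assumes "A \<in> carrier_mat n m" "v \<in> carrier_vec m"
  shows "(c \<cdot>\<^sub>m A) *\<^sub>v v = c \<cdot>\<^sub>v (A *\<^sub>v v :: 'a :: comm_semiring_1 vec)"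
  using assms by (intro eq_vecI) (simp_all add: scalar_prod_def sum_distrib_left mult.assoc)

lemma pow_mat_add:
  assumes "A \<in> carrier_mat n n"
  shows "A ^\<^sub>m (i + j) = A ^\<^sub>m i * (A ^\<^sub>m j :: 'a :: semiring_1 mat)"
proof (induction j)
  case (Suc j)
  then show ?case
    using assms by (simp add: assoc_mult_mat[of _ n n _ n _ n])
qed (use assms in simp)

lemma cscalar_prod_mult_mat_vec:
  fixes A :: "complex mat"
  assumes A: "A \<in> carrier_mat n n" and x: "x \<in> carrier_vec n" and y: "y \<in> carrier_vec n"
  shows "(A *\<^sub>v x) \<bullet>c y = x \<bullet>c (mat_adjoint A *\<^sub>v y)"
proof -
  have "(A *\<^sub>v x) \<bullet>c y = (\<Sum>i<n. \<Sum>j<n. A $$ (i, j) * x $ j * cnj (y $ i))"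
    using assms by (simp add: scalar_prod_def atLeast0LessThan sum_distrib_right)
  also have "\<dots> = (\<Sum>j<n. \<Sum>i<n. A $$ (i, j) * x $ j * cnj (y $ i))"
    by (rule sum.swap)
  also have "\<dots> = x \<bullet>c (mat_adjoint A *\<^sub>v y)"
    using assms by (simp add: scalar_prod_def atLeast0LessThan sum_distrib_left mat_adjoint_entry ac_simps)
  finally show ?thesis .
qed

lemma unitary_adjoint_unique:
  assumes A: "A \<in> unitary_group n" and B: "B \<in> carrier_mat n n" and AB: "A * B = 1\<^sub>m n"
  shows "mat_adjoint A = B"
proof -
  have A': "A \<in> carrier_mat n n" "mat_adjoint A \<in> carrier_mat n n" "mat_adjoint A * A = 1\<^sub>m n"
    using A by (auto simp: unitary_group_def)
  have "mat_adjoint A = mat_adjoint A * (A * B)" using A' AB by simp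
  also have "\<dots> = (mat_adjoint A * A) * B"
    using A' B by (intro assoc_mult_mat[symmetric]) auto
  finally show ?thesis using A' B by simp
qed

lemma unitary_smult:
  assumes "cmod c = 1" "A \<in> unitary_group n"
  shows "c \<cdot>\<^sub>m A \<in> unitary_group n"
proof -
  have A: "A \<in> carrier_mat n n" "mat_adjoint A \<in> carrier_mat n n"
    "A * mat_adjoint A = 1\<^sub>m n" "mat_adjoint A * A = 1\<^sub>m n"
    using assms by (auto simp: unitary_group_def)
  then show ?thesis
    using cmod_mult_cnj[OF assms(1)]
    by (simp add: unitary_group_def mat_adjoint_smult smult_mult_mat[of _ n n _ n] mult.commute)
qed

lemma unitary_one: "1\<^sub>m n \<in> unitary_group n"
  by (auto simp: unitary_group_def)

lemma unitary_pow:
  assumes "A \<in> unitary_group n"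
  shows "A ^\<^sub>m k \<in> unitary_group n"
proof (induction k)
  case 0
  have "dim_row A = n" using assms by (auto simp: unitary_group_def)
  then show ?case by (simp add: unitary_one)
qed (use assms in \<open>simp add: unitary_group_mult\<close>)

text \<open>This is equality in the projective unitary group. Hiding the scalar allows products to
  be compared without tracking a cocycle.\<close>

definition phase_eq :: "complex mat \<Rightarrow> complex mat \<Rightarrow> bool" where
  "phase_eq A B \<longleftrightarrow> (\<exists>c. cmod c = 1 \<and> A = c \<cdot>\<^sub>m B)"

lemma phase_eq_refl: "phase_eq A A"
  unfolding phase_eq_def by (intro exI[of _ 1]) simp

lemma phase_eq_smult: "cmod c = 1 \<Longrightarrow> phase_eq (c \<cdot>\<^sub>m A) A"
  unfolding phase_eq_def by blast

lemma phase_eq_sym: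
  assumes "phase_eq A B"
  shows "phase_eq B A"
proof -
  from assms obtain c where c: "cmod c = 1" "A = c \<cdot>\<^sub>m B" by (auto simp: phase_eq_def)
  then have "B = cnj c \<cdot>\<^sub>m A"
    using cmod_mult_cnj[of c] by (simp add: smult_smult_mat mult.commute)
  then show ?thesis unfolding phase_eq_def using c by (intro exI[of _ "cnj c"]) simp
qed

lemma phase_eq_trans [trans]: "phase_eq A B \<Longrightarrow> phase_eq B C \<Longrightarrow> phase_eq A C"
  unfolding phase_eq_def by (metis norm_mult mult_1 smult_smult_mat)

lemma phase_eq_mult:
  assumes "phase_eq A A'" "phase_eq B B'" "A' \<in> carrier_mat n n" "B' \<in> carrier_mat n n"
  shows "phase_eq (A * B) (A' * B')"
proof -
  from assms obtain c d where "cmod c = 1" "A = c \<cdot>\<^sub>m A'" "cmod d = 1" "B = d \<cdot>\<^sub>m B'"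
    by (auto simp: phase_eq_def)
  then show ?thesis
    unfolding phase_eq_def using assms
    by (intro exI[of _ "c * d"]) (simp add: norm_mult smult_mult_mat[of _ n n _ n])
qed

text \<open>A unimodular scalar has a unimodular square root. Applied to \<open>A = B * B\<close>,
  this gives the factor \<open>r\<close> for which the rescaled \<open>B\<close> is an exact
  involution.\<close>

lemma phase_eq_one_square:
  assumes "phase_eq A (1\<^sub>m n)"
  obtains r where "cmod r = 1" "(r * r) \<cdot>\<^sub>m A = 1\<^sub>m n"
proof -
  from assms obtain c where c: "cmod c = 1" "A = c \<cdot>\<^sub>m 1\<^sub>m n" by (auto simp: phase_eq_def)
  define r where "r = csqrt (cnj c)"
  have r: "r\<^sup>2 = cnj c" by (simp add: r_def)
  then have "(cmod r)\<^sup>2 = 1" using c(1) by (metis complex_mod_cnj norm_power)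
  then have "cmod r = 1" by (simp add: abs_square_eq_1)
  moreover have "(r * r) \<cdot>\<^sub>m A = 1\<^sub>m n"
    using c cmod_mult_cnj[of c] r by (simp add: smult_smult_mat power2_eq_square mult.commute)
  ultimately show ?thesis by (rule that)
qed

section \<open>Unitary matrices satisfying the dihedral relations\<close>

text \<open>Given \<open>T * T = 1\<close>, the equation \<open>U * T * U = T\<close> says that
  conjugation by \<open>T\<close> inverts \<open>U\<close>. Only the relation for the order of the
  rotation is relaxed, by the scalar \<theta>.\<close>

locale dihedral_unitaries =
  fixes n :: nat and U T :: "complex mat" and \<theta> :: complex
  assumes n: "n \<ge> 1"
    and U: "U \<in> unitary_group n" and T: "T \<in> unitary_group n"
    and TT: "T * T = 1\<^sub>m n" and UTU: "U * T * U = T"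
    and U_n: "U ^\<^sub>m n = \<theta> \<cdot>\<^sub>m 1\<^sub>m n"
begin

lemma carrier [simp]: "U \<in> carrier_mat n n" "T \<in> carrier_mat n n"
  using U T by (auto simp: unitary_group_def)

lemma dim_U [simp]: "dim_row U = n" "dim_col U = n"
  by (rule carrier_matD[OF carrier(1)])+

lemmas one_mult [simp] = left_mult_one_mat[of _ n n] right_mult_one_mat[of _ n n]

lemma T_adjoint: "mat_adjoint T = T"
  by (rule unitary_adjoint_unique[OF T]) (simp_all add: TT)

lemma U_pow_T_U_pow: "U ^\<^sub>m k * T * U ^\<^sub>m k = T"
proof (induction k)
  case 0
  then show ?case by simp
next
  case (Suc k)
  have comm: "U ^\<^sub>m Suc k = U * U ^\<^sub>m k" for k
    using pow_mat_add[OF carrier(1), of 1 k] by simp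
  \<comment> \<open>On both sides the factor \<open>U\<close> adjacent to \<open>T\<close> is split
    off, so that \<open>UTU\<close> applies in the middle.\<close>
  have "U ^\<^sub>m Suc k * T * U ^\<^sub>m Suc k = (U ^\<^sub>m k * U) * T * (U * U ^\<^sub>m k)"
    using comm[of k] by simp
  also have "\<dots> = U ^\<^sub>m k * (U * T * U) * U ^\<^sub>m k"
    by (simp add: assoc_mult_mat[of _ n n _ n _ n] mult_carrier_mat[of _ n n _ n])
  finally show ?case by (simp add: UTU Suc)
qed

text \<open>Taking \<open>k = n\<close> in \<open>U_pow_T_U_pow\<close> gives \<theta> twice as a
  factor of \<open>T\<close>, and the invertible \<open>T\<close> cancels.\<close>

lemma theta_square: "\<theta>\<^sup>2 = 1"
proof -
  have "(\<theta> * \<theta>) \<cdot>\<^sub>m T = T"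
  proof -
    have "(\<theta> * \<theta>) \<cdot>\<^sub>m T = (\<theta> \<cdot>\<^sub>m T) * (\<theta> \<cdot>\<^sub>m 1\<^sub>m n)"
      by (simp add: smult_mult_mat[of _ n n _ n])
    also have "\<theta> \<cdot>\<^sub>m T = (\<theta> \<cdot>\<^sub>m 1\<^sub>m n) * T"
      by (simp add: mult_smult_assoc_mat[of _ n n _ n])
    also have "(\<theta> \<cdot>\<^sub>m 1\<^sub>m n) * T * (\<theta> \<cdot>\<^sub>m 1\<^sub>m n) = T" using U_pow_T_U_pow[of n] unfolding U_n .
    finally show ?thesis .
  qed
  then have "(\<theta> * \<theta>) \<cdot>\<^sub>m (T * T) = T * T"
    using mult_smult_assoc_mat[of T n n T n "\<theta> * \<theta>"] by simp
  \<comment> \<open>The entry at \<open>(0, 0)\<close> exists because \<open>n\<close> is positive;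
    it extracts the scalar from the matrix equation.\<close>
  then have "((\<theta> * \<theta>) \<cdot>\<^sub>m 1\<^sub>m n) $$ (0, 0) = (1\<^sub>m n :: complex mat) $$ (0, 0)"
    by (simp add: TT)
  then show ?thesis using n by (simp add: power2_eq_square)
qed

lemma U_pow_2n_mult: "U ^\<^sub>m (2 * n * q) = 1\<^sub>m n"
proof (induction q)
  case 0
  then show ?case by simp
next
  case (Suc q)
  have "U ^\<^sub>m (n + n) = 1\<^sub>m n"
    using theta_square
    by (simp only: pow_mat_add[OF carrier(1)] U_n)
      (simp add: smult_mult_mat[of _ n n _ n] power2_eq_square)
  then show ?case
    using Suc pow_mat_add[OF carrier(1), of "n + n" "2 * n * q"] by (simp add: algebra_simps)
qed

lemma U_pow_mod: "U ^\<^sub>m (m mod (2 * n)) = U ^\<^sub>m m"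
proof -
  have "U ^\<^sub>m m = U ^\<^sub>m (2 * n * (m div (2 * n)) + m mod (2 * n))" by simp
  also have "\<dots> = U ^\<^sub>m (m mod (2 * n))"
    by (subst pow_mat_add[OF carrier(1)]) (simp add: U_pow_2n_mult)
  finally show ?thesis by simp
qed

text \<open>Exponents are reduced modulo \<open>2 * n\<close> because \<open>U ^\<^sub>m n\<close> may be \<open>- 1\<close>.\<close>

definition W :: "int \<Rightarrow> complex mat" where
  "W k = U ^\<^sub>m nat (k mod int (2 * n))"

lemma W_carrier [simp]: "W k \<in> carrier_mat n n"
  by (simp add: W_def)

lemma W_unitary: "W k \<in> unitary_group n"
  unfolding W_def by (rule unitary_pow[OF U])

lemma W_of_nat: "W (int m) = U ^\<^sub>m m"
  unfolding W_def using U_pow_mod[of m] by (simp add: nat_mod_distrib nat_mult_distrib)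

lemma W_add: "W (k + l) = W k * W l"
proof -
  have "nat ((k + l) mod int (2 * n)) = (nat (k mod int (2 * n)) + nat (l mod int (2 * n))) mod (2 * n)"
    using n by (intro int_int_eq[THEN iffD1]) (simp add: zmod_int mod_add_eq)
  then show ?thesis
    unfolding W_def by (simp only: U_pow_mod pow_mat_add[OF carrier(1)])
qed

lemma W_zero: "W 0 = 1\<^sub>m n"
  using W_of_nat[of 0] carrier by simp

lemma W_period: "W (k + int n) = \<theta> \<cdot>\<^sub>m W k"
  by (simp add: W_add W_of_nat U_n mult_smult_distrib[of _ n n _ n])

lemma W_adjoint: "mat_adjoint (W k) = W (- k)"
  by (rule unitary_adjoint_unique[OF W_unitary]) (simp_all add: W_add[symmetric] W_zero)

lemma T_W: "T * W k = W (- k) * T"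
proof -
  have "W k * T * W k = T" unfolding W_def by (rule U_pow_T_U_pow)
  then have "W (- k) * T = W (- k) * (W k * T * W k)" by simp
  also have "\<dots> = (W (- k) * W k) * T * W k"
    by (simp add: assoc_mult_mat[of _ n n _ n _ n] mult_carrier_mat[of _ n n _ n])
  finally show ?thesis by (simp add: W_add[symmetric] W_zero)
qed

text \<open>The adjoint is \<open>T * W (- k)\<close>, and moving \<open>T\<close> to the right
  restores the sign of the exponent. This is what makes the Gram entries between rotations and
  reflections real.\<close>

lemma W_T_adjoint: "mat_adjoint (W k * T) = W k * T"
  by (simp add: mat_adjoint_mult[of _ n n _ n] T_adjoint W_adjoint T_W)

text \<open>Moving \<open>B\<close> to the other side reduces every inner product of two orbit
  vectors to a matrix coefficient at \<open>v\<close>.\<close>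

lemma cscalar_prod_orbit:
  fixes A B :: "complex mat"
  assumes "A \<in> carrier_mat n n" "B \<in> carrier_mat n n" "v \<in> carrier_vec n"
  shows "(A *\<^sub>v v) \<bullet>c (B *\<^sub>v v) = ((mat_adjoint B * A) *\<^sub>v v) \<bullet>c v"
  using cscalar_prod_mult_mat_vec[of "mat_adjoint B" n "A *\<^sub>v v" v] assms
  by (simp add: assoc_mult_mat_vec[of _ n n _ n])

text \<open>These are the four types of quotients in the dihedral group, one for each block of the
  Gram matrix. For two reflections the passage through \<open>T\<close> reverses the difference of
  exponents, and the two copies of \<open>T\<close> cancel.\<close>

lemma gram_products:
  "mat_adjoint (W l) * W k = W (k - l)"
  "mat_adjoint (W l) * (W k * T) = W (k - l) * T"
  "mat_adjoint (W l * T) * W k = W (l - k) * T"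
  "mat_adjoint (W l * T) * (W k * T) = W (l - k)"
proof -
  show 1: "mat_adjoint (W l) * W k = W (k - l)" for k l
    by (simp add: W_adjoint W_add[symmetric])
  show "mat_adjoint (W l) * (W k * T) = W (k - l) * T"
    by (simp add: W_adjoint W_add[symmetric] assoc_mult_mat[of _ n n _ n _ n, symmetric])
  have 3: "mat_adjoint (W l * T) * W k = W (l - k) * T" for k l
  proof -
    have "mat_adjoint (W l * T) * W k = W l * (T * W k)"
      unfolding W_T_adjoint by (simp add: assoc_mult_mat[of _ n n _ n _ n])
    also have "\<dots> = W l * W (- k) * T"
      unfolding T_W by (simp add: assoc_mult_mat[of _ n n _ n _ n])
    finally show ?thesis by (simp add: W_add[symmetric])
  qed
  show "mat_adjoint (W l * T) * W k = W (l - k) * T" by (rule 3)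
  have "mat_adjoint (W l * T) * (W k * T) = mat_adjoint (W l * T) * W k * T"
    by (rule assoc_mult_mat[of _ n n _ n _ n, symmetric]) (simp_all add: mult_carrier_mat[of _ n n _ n])
  then show "mat_adjoint (W l * T) * (W k * T) = W (l - k)"
    by (simp add: 3 assoc_mult_mat[of _ n n _ n _ n] TT)
qed

end

section \<open>From projective representations to exact relations\<close>

lemma sum_lessThan_add:
  fixes f :: "nat \<Rightarrow> 'a :: comm_monoid_add"
  shows "(\<Sum>j<n + m. f j) = (\<Sum>j<n. f j) + (\<Sum>j<m. f (n + j))"
  by (induction m) (simp_all add: add.assoc)

text \<open>Two phases are free, one per generator. The phase of the reflection is spent on
  \<open>T * T = 1\<close> and that of the rotation on making \<open>U * T\<close> an involution;
  the last relation survives up to the scalar \<theta>.\<close>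

lemma dihedral_rep_normal_form:
  assumes rep: "projective_unitary_rep (dihedral_group n) n \<pi>" and n: "n \<ge> 1"
  obtains U T \<theta> where "dihedral_unitaries n U T \<theta>"
    "\<And>k. k < n \<Longrightarrow> phase_eq (\<pi> (int k, False)) (U ^\<^sub>m k)"
    "\<And>k. k < n \<Longrightarrow> phase_eq (\<pi> (int k, True)) (U ^\<^sub>m k * T)"
proof -
  let ?G = "dihedral_group n"
  have un: "\<pi> g \<in> unitary_group n" if "g \<in> carrier ?G" for g
    using rep that by (simp add: projective_unitary_rep_def)
  have car: "\<pi> g \<in> carrier_mat n n" if "g \<in> carrier ?G" for g
    using un[OF that] by (simp add: unitary_group_def)
  have hom: "phase_eq (\<pi> (g \<otimes>\<^bsub>?G\<^esub> h)) (\<pi> g * \<pi> h)" if "g \<in> carrier ?G" "h \<in> carrier ?G" for g h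
    using rep that unfolding projective_unitary_rep_def phase_eq_def by blast
  have mem: "(a, b) \<in> carrier ?G \<longleftrightarrow> 0 \<le> a \<and> a < int n" for a b
    by (auto simp: dihedral_group_def)
  have mult: "(a, b) \<otimes>\<^bsub>?G\<^esub> (c, d) = ((a + (if b then - c else c)) mod int n, b \<noteq> d)" for a b c d
    by (simp add: dihedral_group_def)
  define \<mu> where "\<mu> = dihedral_mu n"
  have \<mu>: "\<mu> = (1 mod int n, False)" by (simp add: \<mu>_def dihedral_mu_def)
  have G: "(0, False) \<in> carrier ?G" "\<mu> \<in> carrier ?G" "(0, True) \<in> carrier ?G"
      "(1 mod int n, True) \<in> carrier ?G"
    using n by (simp_all add: mem \<mu>)
  \<comment> \<open>The identity is idempotent, so its image \<open>?P\<close> equals its own square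
    up to a phase; cancelling one factor leaves a scalar matrix.\<close>
  have one: "phase_eq (\<pi> (0, False)) (1\<^sub>m n)"
  proof -
    let ?P = "\<pi> (0, False)"
    obtain c where c: "cmod c = 1" "?P = c \<cdot>\<^sub>m (?P * ?P)"
      using hom[OF G(1) G(1)] by (auto simp: mult phase_eq_def)
    have P: "?P \<in> carrier_mat n n" "mat_adjoint ?P \<in> carrier_mat n n" "mat_adjoint ?P * ?P = 1\<^sub>m n"
      using un[OF G(1)] by (auto simp: unitary_group_def)
    have "1\<^sub>m n = mat_adjoint ?P * (c \<cdot>\<^sub>m (?P * ?P))" using P(3) c(2) by simp
    also have "\<dots> = c \<cdot>\<^sub>m (mat_adjoint ?P * (?P * ?P))"
      using P by (intro mult_smult_distrib) auto
    also have "mat_adjoint ?P * (?P * ?P) = (mat_adjoint ?P * ?P) * ?P"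
      using P by (intro assoc_mult_mat[symmetric]) auto
    also have "\<dots> = ?P" using P by simp
    finally have "phase_eq (1\<^sub>m n) ?P" using c(1) phase_eq_smult[of c ?P] by simp
    then show ?thesis by (rule phase_eq_sym)
  qed
  have "phase_eq (\<pi> (0, True) * \<pi> (0, True)) (1\<^sub>m n)"
    using phase_eq_trans[OF phase_eq_sym[OF hom[OF G(3) G(3)]]] one by (simp add: mult)
  then obtain s where s: "cmod s = 1" "(s * s) \<cdot>\<^sub>m (\<pi> (0, True) * \<pi> (0, True)) = 1\<^sub>m n"
    by (rule phase_eq_one_square)
  define T where "T = s \<cdot>\<^sub>m \<pi> (0, True)"
  have T: "T \<in> unitary_group n"
    unfolding T_def by (rule unitary_smult[OF s(1) un[OF G(3)]])
  have Tc: "T \<in> carrier_mat n n" using T by (simp add: unitary_group_def)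
  have TT: "T * T = 1\<^sub>m n"
    unfolding T_def s(2)[symmetric] by (rule smult_mult_mat) (rule car[OF G(3)])+
  have piT: "phase_eq (\<pi> (0, True)) T"
    unfolding T_def by (rule phase_eq_sym[OF phase_eq_smult[OF s(1)]])
  have muT: "phase_eq (\<pi> (1 mod int n, True)) (\<pi> \<mu> * T)"
  proof -
    have "phase_eq (\<pi> (1 mod int n, True)) (\<pi> \<mu> * \<pi> (0, True))"
      using hom[OF G(2) G(3)] by (simp add: mult \<mu>)
    also have "phase_eq \<dots> (\<pi> \<mu> * T)"
      by (rule phase_eq_mult[OF phase_eq_refl piT car[OF G(2)] Tc])
    finally show ?thesis .
  qed
  define R where "R = \<pi> \<mu> * T"
  have Rc: "R \<in> carrier_mat n n" unfolding R_def using car[OF G(2)] Tc by simp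
  \<comment> \<open>The pair \<open>(1 mod int n, True)\<close> is the reflection \<mu>\<tau>, whose
    square is the identity; hence \<open>R * R\<close> is scalar.\<close>
  have "phase_eq (R * R) (\<pi> (1 mod int n, True) * \<pi> (1 mod int n, True))"
    unfolding R_def by (rule phase_eq_mult[OF phase_eq_sym[OF muT] phase_eq_sym[OF muT] car[OF G(4)] car[OF G(4)]])
  also have "phase_eq \<dots> (\<pi> (0, False))"
    using phase_eq_sym[OF hom[OF G(4) G(4)]] by (simp add: mult)
  also note one
  finally obtain r where r: "cmod r = 1" "(r * r) \<cdot>\<^sub>m (R * R) = 1\<^sub>m n"
    by (rule phase_eq_one_square)
  \<comment> \<open>Scaling by \<open>r\<close> makes \<open>(U * T) * (U * T) = 1\<close> exact,
    and multiplying by \<open>T\<close> on the right yields \<open>UTU\<close>.\<close>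
  define U where "U = r \<cdot>\<^sub>m \<pi> \<mu>"
  have U: "U \<in> unitary_group n"
    unfolding U_def by (rule unitary_smult[OF r(1) un[OF G(2)]])
  have Uc: "U \<in> carrier_mat n n" using U by (simp add: unitary_group_def)
  have piU: "phase_eq (\<pi> \<mu>) U"
    unfolding U_def by (rule phase_eq_sym[OF phase_eq_smult[OF r(1)]])
  have UT: "U * T = r \<cdot>\<^sub>m R"
    unfolding U_def R_def by (rule mult_smult_assoc_mat[OF car[OF G(2)] Tc])
  have UTUT: "(U * T) * (U * T) = 1\<^sub>m n"
    unfolding UT using Rc r(2) by (simp add: smult_mult_mat[of _ n n _ n])
  have UTU: "U * T * U = T"
  proof -
    have "U * T * U = U * T * U * (T * T)"
      using Uc Tc by (simp add: TT mult_carrier_mat[of _ n n _ n] right_mult_one_mat[of _ n n])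
    also have "\<dots> = (U * T) * (U * T) * T"
      using Uc Tc by (simp add: assoc_mult_mat[of _ n n _ n _ n] mult_carrier_mat[of _ n n _ n])
    finally show ?thesis using Tc by (simp add: UTUT)
  qed
  have piUk: "phase_eq (\<pi> (int k mod int n, False)) (U ^\<^sub>m k)" for k
  proof (induction k)
    case 0
    then show ?case using one Uc by simp
  next
    case (Suc k)
    have k: "(int k mod int n, False) \<in> carrier ?G" using n by (simp add: mem)
    have "(int (Suc k) mod int n, False) = (int k mod int n, False) \<otimes>\<^bsub>?G\<^esub> \<mu>"
      by (simp add: mult \<mu> mod_simps add.commute)
    then have "phase_eq (\<pi> (int (Suc k) mod int n, False)) (\<pi> (int k mod int n, False) * \<pi> \<mu>)"
      using hom[OF k G(2)] by simp
    also have "phase_eq \<dots> (U ^\<^sub>m k * U)"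
      using Uc by (intro phase_eq_mult[OF Suc piU]) auto
    finally show ?case by simp
  qed
  \<comment> \<open>At \<open>k = n\<close> the residue in \<open>piUk\<close> is zero, so this
    power of \<open>U\<close> represents the identity.\<close>
  have "phase_eq (U ^\<^sub>m n) (\<pi> (0, False))"
    using phase_eq_sym[OF piUk[of n]] by simp
  also note one
  finally obtain \<theta> where \<theta>: "U ^\<^sub>m n = \<theta> \<cdot>\<^sub>m 1\<^sub>m n" by (auto simp: phase_eq_def)
  show ?thesis
  proof (rule that)
    show "dihedral_unitaries n U T \<theta>"
      by unfold_locales (fact n U T TT UTU \<theta>)+
    fix k assume k: "k < n"
    then have kc: "(int k, False) \<in> carrier ?G" by (simp add: mem)
    show pk: "phase_eq (\<pi> (int k, False)) (U ^\<^sub>m k)"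
      using piUk[of k] k by simp
    have "phase_eq (\<pi> (int k, True)) (\<pi> (int k, False) * \<pi> (0, True))"
      using hom[OF kc G(3)] k by (simp add: mult)
    also have "phase_eq \<dots> (U ^\<^sub>m k * T)"
      using Uc Tc by (intro phase_eq_mult[OF pk piT]) auto
    finally show "phase_eq (\<pi> (int k, True)) (U ^\<^sub>m k * T)" .
  qed
qed

section \<open>Two sources of switching equivalence\<close>

text \<open>Permuting columns and changing their phases is right multiplication by a phase monomial
  matrix \<open>K\<close>. Since \<open>K\<close> is unitary, it cancels in the frame
  operator.\<close>

lemma switching_equiv_of_columns:
  assumes \<Phi>: "\<Phi> \<in> carrier_mat n N" and \<Psi>: "\<Psi> \<in> carrier_mat n N" and p: "p permutes {..<N}"
    and c: "\<And>j. j < N \<Longrightarrow> cmod (c j) = 1"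
    and col: "\<And>j. j < N \<Longrightarrow> col \<Phi> (p j) = c j \<cdot>\<^sub>v col \<Psi> j"
  shows "(\<Phi>, \<Psi>) \<in> switching_equiv n N" "\<Psi> * mat_adjoint \<Psi> = \<Phi> * mat_adjoint \<Phi>"
proof -
  have pl: "p j < N" if "j < N" for j
    using permutes_in_image[OF p, of j] that by simp
  have ipl: "Hilbert_Choice.inv p j < N" if "j < N" for j
    using permutes_in_image[OF permutes_inv[OF p], of j] that by simp
  \<comment> \<open>The conjugate undoes the phase \<open>c j\<close>. In
    \<open>phase_monomial_iff\<close> phases are indexed by rows, which is why \<open>c\<close> is
    read at the inverse image of \<open>i\<close>.\<close>
  define K where "K = mat N N (\<lambda>(i, j). if i = p j then cnj (c (Hilbert_Choice.inv p i)) else 0)"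
  have K: "phase_monomial N K"
    unfolding phase_monomial_iff K_def
    by (intro exI[of _ p] exI[of _ "\<lambda>i. cnj (c (Hilbert_Choice.inv p i))"]) (simp add: p c ipl)
  have Kc: "K \<in> carrier_mat N N" "mat_adjoint K \<in> carrier_mat N N" "K * mat_adjoint K = 1\<^sub>m N"
    using phase_monomial_unitary[OF K] by (auto simp: unitary_group_def)
  have eq: "\<Psi> = \<Phi> * K"
  proof (rule eq_matI)
    fix r j assume rj: "r < dim_row (\<Phi> * K)" "j < dim_col (\<Phi> * K)"
    then have r: "r < n" and j: "j < N" using \<Phi> Kc by auto
    have "(\<Phi> * K) $$ (r, j) = (\<Sum>i<N. \<Phi> $$ (r, i) * (if i = p j then cnj (c (Hilbert_Choice.inv p i)) else 0))"
      using \<Phi> r j by (simp add: K_def scalar_prod_def atLeast0LessThan)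
    also have "\<dots> = (\<Sum>i<N. if i = p j then \<Phi> $$ (r, p j) * cnj (c j) else 0)"
      by (rule sum.cong) (auto simp: permutes_inverses[OF p])
    also have "\<dots> = col \<Phi> (p j) $ r * cnj (c j)"
      using pl[OF j] r \<Phi> by simp
    also have "\<dots> = (c j * cnj (c j)) * \<Psi> $$ (r, j)"
      using r j \<Psi> by (simp add: col)
    finally show "\<Psi> $$ (r, j) = (\<Phi> * K) $$ (r, j)"
      by (simp add: cmod_mult_cnj c j)
  qed (use \<Phi> \<Psi> Kc in auto)
  \<comment> \<open>Switching multiplies by an adjoint, so the monomial matrix to supply is the
    adjoint of \<open>K\<close>.\<close>
  have "\<Psi> = 1\<^sub>m n * \<Phi> * mat_adjoint (mat_adjoint K)"
    using eq \<Phi> by simp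
  then show "(\<Phi>, \<Psi>) \<in> switching_equiv n N"
    unfolding switching_equiv_def using \<Phi> \<Psi> unitary_one phase_monomial_adjoint[OF K] by blast
  have "\<Psi> * mat_adjoint \<Psi> = \<Phi> * K * (mat_adjoint K * mat_adjoint \<Phi>)"
    unfolding eq using \<Phi> Kc by (simp add: mat_adjoint_mult[of _ n N _ N])
  also have "\<dots> = \<Phi> * (K * (mat_adjoint K * mat_adjoint \<Phi>))"
    using \<Phi> Kc by (intro assoc_mult_mat[of _ n N _ N _ n]) auto
  also have "K * (mat_adjoint K * mat_adjoint \<Phi>) = (K * mat_adjoint K) * mat_adjoint \<Phi>"
    using \<Phi> Kc by (intro assoc_mult_mat[symmetric]) auto
  also have "\<dots> = mat_adjoint \<Phi>" using \<Phi> Kc by simp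
  finally show "\<Psi> * mat_adjoint \<Psi> = \<Phi> * mat_adjoint \<Phi>" .
qed

lemma gram_entry:
  fixes \<Phi> :: "complex mat"
  assumes "\<Phi> \<in> carrier_mat n N" "i < N" "j < N"
  shows "(mat_adjoint \<Phi> * \<Phi>) $$ (i, j) = col \<Phi> j \<bullet>c col \<Phi> i"
proof -
  have "(mat_adjoint \<Phi> * \<Phi>) $$ (i, j) = row (mat_adjoint \<Phi>) i \<bullet> col \<Phi> j"
    using assms by (intro index_mult_mat) simp_all
  also have "\<dots> = (\<Sum>k<n. cnj (\<Phi> $$ (k, i)) * \<Phi> $$ (k, j))"
    using assms by (simp add: scalar_prod_def mat_adjoint_entry atLeast0LessThan)
  also have "\<dots> = col \<Phi> j \<bullet>c col \<Phi> i"
    using assms by (simp add: scalar_prod_def atLeast0LessThan mult.commute)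
  finally show ?thesis .
qed

text \<open>The unitary is half of \<open>\<Psi> * mat_adjoint \<Phi>\<close>: equality of the Gram
  matrices moves the product with \<Phi> to \<open>\<Psi> * mat_adjoint \<Psi> * \<Psi>\<close>, and
  tightness collapses that to twice \<Psi>.\<close>

lemma switching_equiv_of_gram_eq:
  assumes \<Phi>: "\<Phi> \<in> carrier_mat n N" and \<Psi>: "\<Psi> \<in> carrier_mat n N"
    and t\<Phi>: "\<Phi> * mat_adjoint \<Phi> = 2 \<cdot>\<^sub>m 1\<^sub>m n" and t\<Psi>: "\<Psi> * mat_adjoint \<Psi> = 2 \<cdot>\<^sub>m 1\<^sub>m n"
    and gram: "mat_adjoint \<Phi> * \<Phi> = mat_adjoint \<Psi> * \<Psi>"
  shows "(\<Phi>, \<Psi>) \<in> switching_equiv n N"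
proof -
  let ?A = "mat_adjoint \<Phi>" and ?B = "mat_adjoint \<Psi>"
  have c: "?A \<in> carrier_mat N n" "?B \<in> carrier_mat N n" "\<Psi> * ?A \<in> carrier_mat n n"
    using \<Phi> \<Psi> by auto
  define Q where "Q = (1 / 2) \<cdot>\<^sub>m (\<Psi> * ?A)"
  have Qc: "Q \<in> carrier_mat n n" using c by (simp add: Q_def)
  have Q\<Phi>: "Q * \<Phi> = \<Psi>"
  proof -
    have "\<Psi> * ?A * \<Phi> = \<Psi> * (?B * \<Psi>)"
      using \<Phi> \<Psi> c gram by (simp add: assoc_mult_mat[of _ n N _ n _ N])
    also have "\<dots> = (\<Psi> * ?B) * \<Psi>"
      using \<Psi> c by (intro assoc_mult_mat[symmetric]) auto
    also have "\<dots> = 2 \<cdot>\<^sub>m \<Psi>"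
      unfolding t\<Psi> using \<Psi> by (simp add: mult_smult_assoc_mat[of _ n n _ N])
    finally show ?thesis
      unfolding Q_def using c \<Phi> by (simp add: mult_smult_assoc_mat[of _ n n _ N] smult_smult_mat)
  qed
  have "Q * mat_adjoint Q = 1\<^sub>m n"
  proof -
    have "mat_adjoint Q = (1 / 2) \<cdot>\<^sub>m (\<Phi> * ?B)"
      using \<Psi> c by (simp add: Q_def mat_adjoint_smult mat_adjoint_mult[of _ n N _ n])
    then have "Q * mat_adjoint Q = (1 / 2) \<cdot>\<^sub>m (Q * (\<Phi> * ?B))"
      using Qc \<Phi> c by (simp add: mult_smult_distrib[of _ n n _ n])
    also have "Q * (\<Phi> * ?B) = (Q * \<Phi>) * ?B"
      using Qc \<Phi> c by (intro assoc_mult_mat[symmetric]) auto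
    finally show ?thesis by (simp add: Q\<Phi> t\<Psi> smult_smult_mat)
  qed
  moreover from this have "mat_adjoint Q * Q = 1\<^sub>m n"
    by (rule mat_mult_left_right_inverse[rotated 2]) (use Qc in auto)
  ultimately have "Q \<in> unitary_group n" using Qc by (simp add: unitary_group_def)
  moreover have "\<Psi> = Q * \<Phi> * mat_adjoint (1\<^sub>m N)"
    using \<Psi> by (simp add: Q\<Phi>)
  ultimately show ?thesis
    unfolding switching_equiv_def using \<Phi> \<Psi> phase_monomial_one by blast
qed

section \<open>Gram matrices of dihedral equiangular tight frames\<close>

lemma cscalar_prod_smult:
  fixes x y :: "complex vec"
  assumes "x \<in> carrier_vec n" "y \<in> carrier_vec n"
  shows "(c \<cdot>\<^sub>v x) \<bullet>c (d \<cdot>\<^sub>v y) = c * cnj d * (x \<bullet>c y)"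
  using assms by (simp add: scalar_prod_def sum_distrib_left ac_simps)

lemma cnj_cscalar_prod:
  fixes x y :: "complex vec"
  assumes "x \<in> carrier_vec n" "y \<in> carrier_vec n"
  shows "cnj (x \<bullet>c y) = y \<bullet>c x"
  using assms by (simp add: scalar_prod_def ac_simps)

text \<open>Rotations come first and reflections second, which gives the Gram matrix its block
  structure.\<close>

definition dihedral_enum :: "nat \<Rightarrow> nat \<Rightarrow> int \<times> bool" where
  "dihedral_enum n j = (if j < n then (int j, False) else (int (j - n), True))"

lemma bij_betw_dihedral_enum:
  "bij_betw (dihedral_enum n) {..<2 * n} (carrier (dihedral_group n))"
  by (rule bij_betwI[where g = "\<lambda>(a, b). if b then n + nat a else nat a"])
    (auto simp: dihedral_enum_def dihedral_group_def split: if_splits)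

text \<open>Gram matrix of the vectors \<open>U\<^sup>k v\<close> (\<open>k < n\<close>) followed by the \<open>U\<^sup>k T v\<close>, where
  \<open>a k = \<langle>U\<^sup>k v, v\<rangle>\<close> and \<open>b k = \<langle>U\<^sup>k T v, v\<rangle>\<close>.\<close>

definition dihedral_gram :: "nat \<Rightarrow> (int \<Rightarrow> complex) \<Rightarrow> (int \<Rightarrow> complex) \<Rightarrow> complex mat" where
  "dihedral_gram n a b = mat (2 * n) (2 * n) (\<lambda>(i, j).
     if i < n then if j < n then a (int j - int i) else b (int (j - n) - int i)
     else if j < n then b (int (i - n) - int j) else a (int (i - n) - int (j - n)))"

text \<open>Reordering and rephasing the columns replaces the projective orbit by the vectors
  obtained from exact powers of \<open>U\<close> and from \<open>T\<close>. Tightness and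
  equiangularity survive, and the symmetries of \<open>a\<close> and \<open>b\<close> are those of
  \<open>W\<close>.\<close>

lemma dihedral_etf_normal_form:
  assumes etf: "ETF_2n_n n \<Phi>" and dih: "dihedral_configuration n \<Phi>" and n: "n \<ge> 1"
  obtains \<Psi> a b \<theta> \<alpha> where "(\<Phi>, \<Psi>) \<in> switching_equiv n (2 * n)" "\<Psi> \<in> carrier_mat n (2 * n)"
    "\<Psi> * mat_adjoint \<Psi> = 2 \<cdot>\<^sub>m 1\<^sub>m n"
    "mat_adjoint \<Psi> * \<Psi> = dihedral_gram n a b" "\<theta>\<^sup>2 = 1"
    "\<And>k. a (k + int n) = \<theta> * a k" "\<And>k. b (k + int n) = \<theta> * b k"
    "a 0 = 1" "\<And>k. a (- k) = cnj (a k)" "\<And>k. cnj (b k) = b k"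
    "\<And>k. 0 < k \<Longrightarrow> k < n \<Longrightarrow> cmod (a (int k)) = \<alpha>" "\<And>k. k < n \<Longrightarrow> cmod (b (int k)) = \<alpha>"
proof -
  from dih obtain \<pi> v e where rep: "projective_unitary_rep (dihedral_group n) n \<pi>"
    and v: "v \<in> carrier_vec n" and vv: "v \<bullet>c v = 1"
    and e: "bij_betw e {..<2 * n} (carrier (dihedral_group n))"
    and col: "\<And>j. j < 2 * n \<Longrightarrow> col \<Phi> j = \<pi> (e j) *\<^sub>v v"
    by (auto simp: dihedral_configuration_def)
  from etf obtain \<alpha> where \<Phi>: "\<Phi> \<in> carrier_mat n (2 * n)"
    and tight: "\<Phi> * mat_adjoint \<Phi> = 2 \<cdot>\<^sub>m 1\<^sub>m n"
    and ang: "\<And>i j. i < 2 * n \<Longrightarrow> j < 2 * n \<Longrightarrow> i \<noteq> j \<Longrightarrow> cmod (col \<Phi> i \<bullet>c col \<Phi> j) = \<alpha>"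
    by (auto simp: ETF_2n_n_def)
  from dihedral_rep_normal_form[OF rep n] obtain U T \<theta> where "dihedral_unitaries n U T \<theta>"
    and pF: "\<And>k. k < n \<Longrightarrow> phase_eq (\<pi> (int k, False)) (U ^\<^sub>m k)"
    and pT: "\<And>k. k < n \<Longrightarrow> phase_eq (\<pi> (int k, True)) (U ^\<^sub>m k * T)"
    by blast
  then interpret dihedral_unitaries n U T \<theta> by simp
  define X where "X j = (if j < n then W (int j) else W (int (j - n)) * T)" for j
  have X [simp]: "X j \<in> carrier_mat n n" for j
    by (simp add: X_def mult_carrier_mat[of _ n n _ n])
  define \<Psi> where "\<Psi> = mat n (2 * n) (\<lambda>(r, j). (X j *\<^sub>v v) $ r)"
  have \<Psi>: "\<Psi> \<in> carrier_mat n (2 * n)" by (simp add: \<Psi>_def)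
  have col\<Psi>: "col \<Psi> j = X j *\<^sub>v v" if "j < 2 * n" for j
    using that carrier_matD[OF X, of j] by (intro eq_vecI) (simp_all add: \<Psi>_def)
  \<comment> \<open>Column \<open>p j\<close> of \<Phi> belongs to the group element
    \<open>dihedral_enum n j\<close>. Outside the index range \<open>p\<close> is the identity, as
    \<open>permutes\<close> demands.\<close>
  define p where "p j = (if j < 2 * n then inv_into {..<2 * n} e (dihedral_enum n j) else j)" for j
  have "bij_betw (inv_into {..<2 * n} e \<circ> dihedral_enum n) {..<2 * n} {..<2 * n}"
    by (rule bij_betw_trans[OF bij_betw_dihedral_enum bij_betw_inv_into[OF e]])
  then have "bij_betw p {..<2 * n} {..<2 * n}"
    by (rule bij_betw_cong[THEN iffD1, rotated]) (simp add: p_def)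
  then have p: "p permutes {..<2 * n}"
    by (rule bij_imp_permutes) (simp add: p_def)
  have pl: "p j < 2 * n" if "j < 2 * n" for j
    using permutes_in_image[OF p, of j] that by simp
  have ep: "e (p j) = dihedral_enum n j" if "j < 2 * n" for j
    using that bij_betw_inv_into_right[OF e] bij_betwE[OF bij_betw_dihedral_enum]
    by (simp add: p_def)
  have "\<exists>c. cmod c = 1 \<and> \<pi> (e (p j)) = c \<cdot>\<^sub>m X j" if "j < 2 * n" for j
  proof (cases "j < n")
    case True
    then show ?thesis
      using pF[of j] that by (simp add: ep X_def dihedral_enum_def W_of_nat phase_eq_def)
  next
    case False
    then show ?thesis
      using pT[of "j - n"] that
      by (simp add: ep X_def dihedral_enum_def W_of_nat phase_eq_def del: of_nat_diff)
  qed
  then obtain c where c: "\<And>j. j < 2 * n \<Longrightarrow> cmod (c j) = 1"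
    and pc: "\<And>j. j < 2 * n \<Longrightarrow> \<pi> (e (p j)) = c j \<cdot>\<^sub>m X j"
    by metis
  have colp: "col \<Phi> (p j) = c j \<cdot>\<^sub>v col \<Psi> j" if "j < 2 * n" for j
    using that v pl by (simp add: col pc col\<Psi> smult_mat_mult_vec[of _ n n])
  have ang\<Psi>: "cmod (col \<Psi> j \<bullet>c col \<Psi> i) = \<alpha>" if "i < 2 * n" "j < 2 * n" "i \<noteq> j" for i j
  proof -
    have "p j \<noteq> p i" using that permutes_inj[OF p] by (auto dest: injD)
    then have "\<alpha> = cmod (col \<Phi> (p j) \<bullet>c col \<Phi> (p i))"
      using ang[of "p j" "p i"] pl that by simp
    also have "\<dots> = cmod (c j * cnj (c i) * (col \<Psi> j \<bullet>c col \<Psi> i))"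
      using that \<Psi> by (subst (1 2) colp, simp, simp, subst cscalar_prod_smult[of _ n]) auto
    finally show ?thesis using c that by (simp add: norm_mult)
  qed
  define a where "a k = (W k *\<^sub>v v) \<bullet>c v" for k
  define b where "b k = ((W k * T) *\<^sub>v v) \<bullet>c v" for k
  have WTc: "W k * T \<in> carrier_mat n n" for k
    by (simp add: mult_carrier_mat[of _ n n _ n])
  have gram: "mat_adjoint \<Psi> * \<Psi> = dihedral_gram n a b"
  proof (rule eq_matI)
    fix i j assume "i < dim_row (dihedral_gram n a b)" "j < dim_col (dihedral_gram n a b)"
    then have ij: "i < 2 * n" "j < 2 * n" by (simp_all add: dihedral_gram_def)
    then have "(mat_adjoint \<Psi> * \<Psi>) $$ (i, j) = ((mat_adjoint (X i) * X j) *\<^sub>v v) \<bullet>c v"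
      using gram_entry[OF \<Psi> ij] cscalar_prod_orbit[OF X X v] by (simp add: col\<Psi>)
    also have "\<dots> = dihedral_gram n a b $$ (i, j)"
      using ij by (simp add: dihedral_gram_def X_def gram_products a_def b_def)
    finally show "(mat_adjoint \<Psi> * \<Psi>) $$ (i, j) = dihedral_gram n a b $$ (i, j)" .
  qed (use \<Psi> in \<open>auto simp: dihedral_gram_def\<close>)
  have adj: "cnj ((A *\<^sub>v v) \<bullet>c v) = (mat_adjoint A *\<^sub>v v) \<bullet>c v" if "A \<in> carrier_mat n n" for A
    using cscalar_prod_mult_mat_vec[of "mat_adjoint A" n v v] cnj_cscalar_prod[of "A *\<^sub>v v" n v] that v
    by simp
  have entry: "cmod (dihedral_gram n a b $$ (i, j)) = \<alpha>" if "i < 2 * n" "j < 2 * n" "i \<noteq> j" for i j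
    using ang\<Psi>[OF that] gram_entry[OF \<Psi> that(1,2)] gram by simp
  have scale: "((d \<cdot>\<^sub>m A) *\<^sub>v v) \<bullet>c v = d * ((A *\<^sub>v v) \<bullet>c v)" if "A \<in> carrier_mat n n" for d A
    using that v cscalar_prod_smult[of "A *\<^sub>v v" n v d 1] mult_mat_vec_carrier[OF that v]
    by (simp only: smult_mat_mult_vec[of _ n n] one_smult_vec complex_cnj_one mult_1_right)
  note sw = switching_equiv_of_columns[OF \<Phi> \<Psi> p c colp]
  show ?thesis
  proof (rule that[of \<Psi> a b \<theta> \<alpha>])
    show "(\<Phi>, \<Psi>) \<in> switching_equiv n (2 * n)" by (rule sw(1))
    show "\<Psi> * mat_adjoint \<Psi> = 2 \<cdot>\<^sub>m 1\<^sub>m n" using sw(2) tight by simp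
    show "a (k + int n) = \<theta> * a k" for k
      by (simp add: a_def W_period scale)
    show "b (k + int n) = \<theta> * b k" for k
      by (simp add: b_def W_period scale WTc mult_smult_assoc_mat[of _ n n _ n])
    show "a 0 = 1" using v vv by (simp add: a_def W_zero)
    show "a (- k) = cnj (a k)" for k by (simp add: a_def adj W_adjoint)
    show "cnj (b k) = b k" for k by (simp add: b_def adj WTc W_T_adjoint)
    \<comment> \<open>Row 0 of the Gram matrix lists the values of \<open>a\<close> and then, from
      column \<open>n\<close> on, those of \<open>b\<close>; only \<open>a 0\<close> lies on the
      diagonal.\<close>
    show "cmod (a (int k)) = \<alpha>" if "0 < k" "k < n" for k
      using entry[of 0 k] that by (simp add: dihedral_gram_def)
    show "cmod (b (int k)) = \<alpha>" if "k < n" for k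
      using entry[of 0 "n + k"] that by (simp add: dihedral_gram_def)
  qed (fact \<Psi> gram theta_square)+
qed

section \<open>A finite set of candidate Gram matrices\<close>

text \<open>It serves for arguments strictly between \<open>- n\<close> and \<open>n\<close>, the
  index differences occurring in \<open>dihedral_gram\<close>. On the negative ones a factor
  \<theta> replaces its inverse, as both agree when the square of \<theta> is 1.\<close>

definition quasiperiodic_extension :: "nat \<Rightarrow> complex \<Rightarrow> (nat \<Rightarrow> complex) \<Rightarrow> int \<Rightarrow> complex" where
  "quasiperiodic_extension n \<theta> f k = (if k \<ge> 0 then f (nat k) else \<theta> * f (nat (k + int n)))"

lemma quasiperiodic_extension_restrict:
  assumes "\<theta>\<^sup>2 = 1" "\<And>k. f (k + int n) = \<theta> * f k" "- int n < k" "k < int n"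
  shows "quasiperiodic_extension n \<theta> (\<lambda>k\<in>{..<n}. f (int k)) k = f k"
proof (cases "k \<ge> 0")
  case True
  then show ?thesis using assms(4) by (simp add: quasiperiodic_extension_def nat_less_iff)
next
  case False
  then have "quasiperiodic_extension n \<theta> (\<lambda>k\<in>{..<n}. f (int k)) k = \<theta> * f (k + int n)"
    using assms(3) by (simp add: quasiperiodic_extension_def nat_less_iff)
  also have "\<dots> = \<theta>\<^sup>2 * f k"
    unfolding assms(2) by (simp add: power2_eq_square)
  finally show ?thesis by (simp add: assms(1))
qed

lemma dihedral_gram_cong:
  assumes "\<And>k. - int n < k \<Longrightarrow> k < int n \<Longrightarrow> a k = a' k"
    "\<And>k. - int n < k \<Longrightarrow> k < int n \<Longrightarrow> b k = b' k"
  shows "dihedral_gram n a b = dihedral_gram n a' b'"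
  unfolding dihedral_gram_def by (rule eq_matI) (auto intro!: assms)

text \<open>The choices are made in turn: the sign \<theta>, then the values of \<open>b\<close> as
  square roots of the squared common modulus of an equiangular tight frame of this size, then
  \<open>a\<close> subject to the quadratic equations that \<open>b\<close> determines.\<close>

definition dihedral_gram_candidates :: "nat \<Rightarrow> complex mat set" where
  "dihedral_gram_candidates n =
     (\<Union>\<theta> \<in> {\<theta>. \<theta>\<^sup>2 = 1}. \<Union>b \<in> {..<n} \<rightarrow>\<^sub>E {z. z\<^sup>2 = 1 / (2 * of_nat n - 1)}.
       (\<lambda>a. dihedral_gram n (quasiperiodic_extension n \<theta> a) (quasiperiodic_extension n \<theta> b)) `
       {a \<in> {..<n} \<rightarrow>\<^sub>E UNIV. \<forall>w. w ^ n = \<theta> \<longrightarrow>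
         (\<Sum>k<n. a k * w ^ k)\<^sup>2 + (\<Sum>k<n. b k * w ^ k) * (\<Sum>k<n. b k * inverse w ^ k)
           = 2 * (\<Sum>k<n. a k * w ^ k)})"

lemma finite_dihedral_gram_candidates:
  assumes "n \<ge> 1"
  shows "finite (dihedral_gram_candidates n)"
  unfolding dihedral_gram_candidates_def using assms
  by (intro finite_UN_I finite_imageI finite_coeffs_quadratic_at_roots finite_PiE finite_nth_roots)
    (simp_all, force)

text \<open>Tightness makes half the Gram matrix idempotent. Row 0 of that identity is a convolution
  identity: its entry at 0 determines the common modulus, and its Fourier transform gives the
  quadratic equations for \<open>a\<close>.\<close>

lemma dihedral_gram_in_candidates:
  assumes n: "n \<ge> 1" and \<Psi>: "\<Psi> \<in> carrier_mat n (2 * n)"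
    and tight: "\<Psi> * mat_adjoint \<Psi> = 2 \<cdot>\<^sub>m 1\<^sub>m n"
    and gram: "mat_adjoint \<Psi> * \<Psi> = dihedral_gram n a b" and th: "\<theta>\<^sup>2 = 1"
    and a: "\<And>k. a (k + int n) = \<theta> * a k" and b: "\<And>k. b (k + int n) = \<theta> * b k"
    and a0: "a 0 = 1" and a_cnj: "\<And>k. a (- k) = cnj (a k)" and b_real: "\<And>k. cnj (b k) = b k"
    and a_abs: "\<And>k. 0 < k \<Longrightarrow> k < n \<Longrightarrow> cmod (a (int k)) = \<alpha>"
    and b_abs: "\<And>k. k < n \<Longrightarrow> cmod (b (int k)) = \<alpha>"
  shows "mat_adjoint \<Psi> * \<Psi> \<in> dihedral_gram_candidates n"
proof -
  let ?G = "dihedral_gram n a b" and ?P = "mat_adjoint \<Psi>"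
  have P: "?P \<in> carrier_mat (2 * n) n" using \<Psi> by simp
  have GG: "?G * ?G = 2 \<cdot>\<^sub>m ?G"
  proof -
    have "?G * ?G = ?P * (\<Psi> * (?P * \<Psi>))"
      unfolding gram[symmetric] using P \<Psi> by (intro assoc_mult_mat) auto
    also have "\<Psi> * (?P * \<Psi>) = (\<Psi> * ?P) * \<Psi>"
      using P \<Psi> by (intro assoc_mult_mat[symmetric]) auto
    also have "\<dots> = 2 \<cdot>\<^sub>m \<Psi>"
      unfolding tight using \<Psi> by (simp add: mult_smult_assoc_mat[of _ n n _ "2 * n"])
    finally show ?thesis
      using P \<Psi> by (simp add: mult_smult_distrib[of _ "2 * n" n _ "2 * n"] gram)
  qed
  \<comment> \<open>The sum defining the entry \<open>(0, m)\<close> is split at \<open>n\<close>,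
    into rotations and reflections.\<close>
  have conv: "(\<Sum>k<n. a (int k) * a (int m - int k)) + (\<Sum>k<n. b (int k) * b (int k - int m)) = 2 * a (int m)"
    if m: "m < n" for m
  proof -
    have G: "?G \<in> carrier_mat (2 * n) (2 * n)" by (simp add: dihedral_gram_def)
    have "(?G * ?G) $$ (0, m) = (\<Sum>j<n + n. ?G $$ (0, j) * ?G $$ (j, m))"
      using n m G by (simp add: scalar_prod_def atLeast0LessThan mult_2)
    also have "\<dots> = (\<Sum>k<n. a (int k) * a (int m - int k)) + (\<Sum>k<n. b (int k) * b (int k - int m))"
      unfolding sum_lessThan_add using n m
      by (intro arg_cong2[of _ _ _ _ "(+)"] sum.cong) (auto simp: dihedral_gram_def)
    also have "(?G * ?G) $$ (0, m) = 2 * a (int m)"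
      unfolding GG using n m by (simp add: dihedral_gram_def)
    finally show ?thesis by simp
  qed
  \<comment> \<open>Because \<open>b\<close> is real, its square is its squared modulus; for
    \<open>a\<close> the partner at the negated index supplies the conjugate.\<close>
  have bb: "(b (int k))\<^sup>2 = of_real (\<alpha>\<^sup>2)" if "k < n" for k
    using complex_norm_square[of "b (int k)"] b_abs[OF that] b_real[of "int k"]
    by (simp add: power2_eq_square)
  have aa: "a (int k) * a (- int k) = of_real (if k = 0 then 1 else \<alpha>\<^sup>2)" if "k < n" for k
    using complex_norm_square[of "a (int k)"] a_abs[of k] a_cnj[of "int k"] a0 that by auto
  \<comment> \<open>This is \<open>conv\<close> at \<open>m = 0\<close>: the unit vector contributes
    1 and the remaining \<open>2 * n - 1\<close> terms contribute the squared modulus each.\<close>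
  have "of_real (1 + (real n - 1) * \<alpha>\<^sup>2 + real n * \<alpha>\<^sup>2) = (2 :: complex)"
  proof -
    have "2 = (\<Sum>k<n. a (int k) * a (- int k)) + (\<Sum>k<n. (b (int k))\<^sup>2)"
      using conv[of 0] n a0 by (simp add: power2_eq_square)
    also have "\<dots> = of_real ((\<Sum>k<n. if k = 0 then 1 else \<alpha>\<^sup>2) + (\<Sum>k<n. \<alpha>\<^sup>2))"
      by (simp only: of_real_add of_real_sum) (simp add: aa bb)
    also have "(\<Sum>k<n. if k = 0 then 1 else \<alpha>\<^sup>2) = 1 + (real n - 1) * \<alpha>\<^sup>2"
      using n by (cases n) (simp_all add: sum.lessThan_Suc_shift del: sum.lessThan_Suc)
    finally show ?thesis by simp
  qed
  then have "1 + (real n - 1) * \<alpha>\<^sup>2 + real n * \<alpha>\<^sup>2 = 2"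
    by (metis of_real_eq_iff of_real_numeral)
  then have "\<alpha>\<^sup>2 = 1 / (2 * real n - 1)"
    using n by (simp add: field_simps)
  then have b2: "(b (int k))\<^sup>2 = 1 / (2 * of_nat n - 1)" if "k < n" for k
    using bb[OF that] by simp
  define a' where "a' = (\<lambda>k\<in>{..<n}. a (int k))"
  define b' where "b' = (\<lambda>k\<in>{..<n}. b (int k))"
  have "?G = dihedral_gram n (quasiperiodic_extension n \<theta> a') (quasiperiodic_extension n \<theta> b')"
    unfolding a'_def b'_def
    by (rule dihedral_gram_cong)
      (rule quasiperiodic_extension_restrict[symmetric, OF th]; simp add: a b)+
  moreover have "b' \<in> {..<n} \<rightarrow>\<^sub>E {z. z\<^sup>2 = 1 / (2 * of_nat n - 1)}"
    using b2 by (auto simp: b'_def)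
  moreover have "a' \<in> {..<n} \<rightarrow>\<^sub>E UNIV" by (auto simp: a'_def)
  moreover have "(\<Sum>k<n. a' k * w ^ k)\<^sup>2 + (\<Sum>k<n. b' k * w ^ k) * (\<Sum>k<n. b' k * inverse w ^ k)
           = 2 * (\<Sum>k<n. a' k * w ^ k)" if "w ^ n = \<theta>" for w
    using fourier_quadratic[of \<theta> w n a b, OF th that _ a b conv] n by (simp add: a'_def b'_def)
  ultimately show ?thesis
    unfolding gram dihedral_gram_candidates_def using th by blast
qed

section \<open>Finiteness of the set of switching classes\<close>

theorem theorem4p17:
  fixes n :: nat
  shows "finite ({\<Phi>. ETF_2n_n n \<Phi> \<and> dihedral_configuration n \<Phi>} // switching_equiv n (2 * n))"
proof (cases "n = 0")
  case True
  \<comment> \<open>In dimension zero the empty matrix is the only possible configuration.\<close>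
  have "{\<Phi>. ETF_2n_n n \<Phi> \<and> dihedral_configuration n \<Phi>} \<subseteq> {0\<^sub>m 0 0}"
  proof
    fix \<Phi> assume "\<Phi> \<in> {\<Phi>. ETF_2n_n n \<Phi> \<and> dihedral_configuration n \<Phi>}"
    then have "\<Phi> \<in> carrier_mat 0 0" using True by (simp add: ETF_2n_n_def)
    then have "\<Phi> = 0\<^sub>m 0 0" by (intro eq_matI) simp_all
    then show "\<Phi> \<in> {0\<^sub>m 0 0}" by simp
  qed
  then have "finite {\<Phi>. ETF_2n_n n \<Phi> \<and> dihedral_configuration n \<Phi>}"
    by (rule finite_subset) simp
  then show ?thesis
    by (auto simp: quotient_def)
next
  case False
  then have n: "n \<ge> 1" by simp
  show ?thesis
  \<comment> \<open>Switching may change the Gram matrix, so it is compared only between tight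
    representatives, and each class is represented by one in normal form.\<close>
  proof (rule finite_quotient_by_invariant[where h = "\<lambda>\<Psi>. mat_adjoint \<Psi> * \<Psi>"
        and P = "\<lambda>\<Psi>. \<Psi> \<in> carrier_mat n (2 * n) \<and> \<Psi> * mat_adjoint \<Psi> = 2 \<cdot>\<^sub>m 1\<^sub>m n",
        OF switching_equiv_equiv finite_dihedral_gram_candidates[OF n]])
    fix \<Phi> assume "\<Phi> \<in> {\<Phi>. ETF_2n_n n \<Phi> \<and> dihedral_configuration n \<Phi>}"
    then have \<Phi>: "ETF_2n_n n \<Phi>" "dihedral_configuration n \<Phi>" by simp_all
    show "\<exists>\<Psi>. (\<Phi>, \<Psi>) \<in> switching_equiv n (2 * n) \<and>
        (\<Psi> \<in> carrier_mat n (2 * n) \<and> \<Psi> * mat_adjoint \<Psi> = 2 \<cdot>\<^sub>m 1\<^sub>m n) \<and>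
        mat_adjoint \<Psi> * \<Psi> \<in> dihedral_gram_candidates n"
    proof (rule dihedral_etf_normal_form[OF \<Phi> n])
      fix \<Psi> a b \<theta> \<alpha>
      assume \<Psi>: "(\<Phi>, \<Psi>) \<in> switching_equiv n (2 * n)" "\<Psi> \<in> carrier_mat n (2 * n)"
        "\<Psi> * mat_adjoint \<Psi> = 2 \<cdot>\<^sub>m 1\<^sub>m n"
        "mat_adjoint \<Psi> * \<Psi> = dihedral_gram n a b" "\<theta>\<^sup>2 = 1"
        "\<And>k. a (k + int n) = \<theta> * a k" "\<And>k. b (k + int n) = \<theta> * b k"
        "a 0 = 1" "\<And>k. a (- k) = cnj (a k)" "\<And>k. cnj (b k) = b k"
        "\<And>k. 0 < k \<Longrightarrow> k < n \<Longrightarrow> cmod (a (int k)) = \<alpha>" "\<And>k. k < n \<Longrightarrow> cmod (b (int k)) = \<alpha>"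
      from \<Psi>(1-3) dihedral_gram_in_candidates[OF n \<Psi>(2-)] show ?thesis
        by (intro exI[of _ \<Psi>] conjI)
    qed
  qed (rule switching_equiv_of_gram_eq; simp)
qed

end
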